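(* Assume (G0)–(G4). Let $W$ be a random vector in $\mathbb Z^d$ such that, for some $\varepsilon,v>0$, (i) $\mathbb E|W-nc|_\Sigma^2\le dvn$ and (ii) $d_{\mathrm{TV}}(\mathcal L(W),\mathcal L(W+e^{(j)}))\le\varepsilon$ for each $1\le j\le d$. Then for any $\delta\le\delta_0/\sqrt{\lambda_{\max}(\Sigma)}$, any $0<\delta'\le\delta/2$, any $h:\mathbb Z^d\to\mathbb R$, and $n\ge\max\{n_3,\psi^{-1}(\delta/2)\}$, $$\bigl|\mathbb E\{(\mathcal A_n^\delta h(W)-\widetilde{\mathcal A}_nh(W))\mathbf 1[|W-nc|_\Sigma\le n\delta'/3]\}\bigr|\le d^{5/2}\bar\Lambda\Bigl(\tfrac12L_2\lambda_{\max}(\Sigma)v\|\Delta h\|^\Sigma_{n\delta/4,\infty}+n\|\Delta^2h\|^\Sigma_{n\delta/4,\infty}\Bigl\{L_1\sqrt{v\lambda_{\max}(\Sigma)}\,n^{-1/2}+d^{1/2}(\bar\gamma/\bar\Lambda)\varepsilon+\frac{32d^{1/2}v}{n(\delta')^2}\Bigr\}\Bigr).$$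
   Context: Fix integers $d\ge1$, $n\ge d^4$ (standing assumption). Let $\mathcal J\subset\mathbb Z^d$ be finite, $g^J:\mathbb R^d\to[0,\infty)$ for $J\in\mathcal J$ (set $g^J:=0$ for $J\notin\mathcal J$), $F(\xi):=\sum_JJg^J(\xi)$, $\sigma^2(x):=\sum_JJJ^Tg^J(x)$. Fix $c\in\mathbb R^d$, $\delta_0>0$, $B_{\delta_0}(c):=\{x:|x-c|\le\delta_0\}$. Assumptions: (G0) $F(c)=0$; (G1) all eigenvalues of $A:=DF(c)$ have negative real part; (G2) each $g^J$ is $C^2$ on $B_{\delta_0}(c)$; (G3) there is $\varepsilon_0>0$ with $\inf_{B_{\delta_0}(c)}g^J\ge\varepsilon_0g^J(c)>0$ for all $J\in\mathcal J$; (G4) each $e^{(j)}$ is a finite sum of elements of $\mathcal J$. Let $\sigma^2:=\sigma^2(c)$, $\Sigma$ the positive definite symmetric solution of $A\Sigma+\Sigma A^T+\sigma^2=0$, $|Y|_\Sigma:=(Y^T\Sigma^{-1}Y)^{1/2}$, $\widetilde B_{n,\delta}(c):=\{X\in\mathbb Z^d:|X-nc|_\Sigma\le n\delta\}$. Generator of the restricted process: $\mathcal A_n^\delta h(X):=n\sum_Jg^J_\delta(n^{-1}X)\{h(X+J)-h(X)\}$, with $g^J_\delta(n^{-1}X)=g^J(n^{-1}X)$ if $X,X+J\in\widetilde B_{n,\delta}(c)$ and $0$ otherwise. Simplified operator: $\widetilde{\mathcal A}_nh(w):=\frac n2\mathrm{Tr}(\sigma^2\Delta^2h(w))+\Delta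 h(w)^TA(w-nc)$, where $\Delta_jh(w):=h(w+e^{(j)})-h(w)$, $\Delta_{jk}h:=\Delta_j\Delta_kh$, $\Delta h=(\Delta_jh)_j$, $\Delta^2h=(\Delta_{jk}h)_{jk}$. Norms: $\|\Delta h\|^\Sigma_{a,\infty}:=\max\{\max_j|\Delta_jh(X)|:|X-nc|_\Sigma\le a\}$, $\|\Delta^2h\|^\Sigma_{a,\infty}:=\max\{\max_{j,k}|\Delta_{jk}h(X)|:|X-nc|_\Sigma\le a\}$. Notation: $\lambda_{\min},\lambda_{\max}$ extreme eigenvalues, $\rho(M):=\lambda_{\max}(M)/\lambda_{\min}(M)$; $L_0,L_1,L_2$ are $\max_J\sup_{B_{\delta_0}(c)}$ of $g^J,|Dg^J|,\|D^2g^J\|$ divided by $g^J(c)$; $\bar\Lambda:=d^{-1}\mathrm{Tr}(\sigma^2)$; $\bar\gamma:=d^{-3/2}\sum_Jg^J(c)|J|^3$; $J^\Sigma_{\max}:=\max_J|\Sigma^{-1/2}J|$; $\sigma^2_\Sigma:=\Sigma^{-1/2}\sigma^2\Sigma^{-1/2}$; $\alpha_1:=\frac12\lambda_{\min}(\sigma^2_\Sigma)$; $K_*:=(2L_0\mathrm{Tr}(\sigma^2_\Sigma)/(d\alpha_1))^{1/2}$; $\delta_*:=\delta_0/\sqrt{\lambda_{\max}(\Sigma)}$; $\theta_1:=d^{-1}\min\{1/(3d^{-1}J^\Sigma_{\max}\delta_* ),1/(64L_0\rho(\sigma^2)\rho(\Sigma)),1/(4(d^{-1}J^\Sigma_{\max})^2)\}$;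 $n_*:=(d^{-1}J^\Sigma_{\max}/\delta_* )^{4/3}$; $K_2:=L_0\exp\{\theta_1(K_*+d^{-1}J^\Sigma_{\max})^2\}$; $n_2(T):=\max\{K_2\bar\Lambda T,n_*\}$; $\psi(m):=4\sqrt{\log m/((d\theta_1)m^{3/4})}$, $\psi^{-1}(\eta):=\min\{m\ge4:\psi(m)\le\eta\}$; $g^{(j)}:=g^{-e^{(j)}}(c)$; $I^{(j)}:=\{i:A_{ij}\ne0\}$; $G^{(j)}:=\sum_{i\in I^{(j)}}g^{e^{(i)}}(c)$; $g_*:=\min_j\min\{g^{(j)},G^{(j)}\}$; $n_3:=\max\{(5d^{-1}J^\Sigma_{\max}\max\{1,\sqrt{d\theta_1}\})^{8/3},n_2(1/g_* )\}$. *)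

theory Defs
  imports "HOL-Analysis.Analysis" "HOL-Probability.Probability_Mass_Function"
begin

text \<open>Z^d is rendered as int^'d, R^d as real^'d, with d = CARD('d).\<close>

definition rvec :: "int^'d \<Rightarrow> real^'d" where
  "rvec X = (\<chi> i. real_of_int (X $ i))"

definition ee :: "'d \<Rightarrow> int^'d" where
  "ee j = axis j 1"

definition Fdrift :: "(int^'d) set \<Rightarrow> (int^'d \<Rightarrow> real^'d \<Rightarrow> real) \<Rightarrow> real^'d \<Rightarrow> real^'d" where
  "Fdrift Js g \<xi> = (\<Sum>J\<in>Js. g J \<xi> *\<^sub>R rvec J)"

definition sigma2 :: "(int^'d) set \<Rightarrow> (int^'d \<Rightarrow> real^'d \<Rightarrow> real) \<Rightarrow> real^'d \<Rightarrow> real^'d^'d" where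
  "sigma2 Js g x = (\<chi> i k. \<Sum>J\<in>Js. real_of_int (J $ i) * real_of_int (J $ k) * g J x)"

definition real_eigenvalues :: "real^'d^'d \<Rightarrow> real set" where
  "real_eigenvalues M = {\<mu>. \<exists>v. v \<noteq> 0 \<and> M *v v = \<mu> *\<^sub>R v}"

definition complex_eigenvalues :: "real^'d^'d \<Rightarrow> complex set" where
  "complex_eigenvalues M = {\<mu>. \<exists>v::complex^'d. v \<noteq> 0 \<and>
      (\<chi> i. \<Sum>k\<in>UNIV. complex_of_real (M $ i $ k) * v $ k) = \<mu> *s v}"

definition lam_max :: "real^'d^'d \<Rightarrow> real" where
  "lam_max M = Max (real_eigenvalues M)"

definition lam_min :: "real^'d^'d \<Rightarrow> real" where
  "lam_min M = Min (real_eigenvalues M)"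

definition rho :: "real^'d^'d \<Rightarrow> real" where
  "rho M = lam_max M / lam_min M"

definition pos_def :: "real^'d^'d \<Rightarrow> bool" where
  "pos_def M \<longleftrightarrow> (\<forall>x. x \<noteq> 0 \<longrightarrow> x \<bullet> (M *v x) > 0)"

definition symmetric_mat :: "real^'d^'d \<Rightarrow> bool" where
  "symmetric_mat M \<longleftrightarrow> transpose M = M"

definition msqrt :: "real^'d^'d \<Rightarrow> real^'d^'d" where
  "msqrt M = (THE S. symmetric_mat S \<and> pos_def S \<and> S ** S = M)"

definition inv_sqrt :: "real^'d^'d \<Rightarrow> real^'d^'d" where
  "inv_sqrt M = matrix_inv (msqrt M)"

definition normS :: "real^'d^'d \<Rightarrow> real^'d \<Rightarrow> real" where
  "normS Sig Y = sqrt (Y \<bullet> (matrix_inv Sig *v Y))"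

definition Btilde :: "real^'d^'d \<Rightarrow> nat \<Rightarrow> real \<Rightarrow> real^'d \<Rightarrow> (int^'d) set" where
  "Btilde Sig n \<delta> c = {X. normS Sig (rvec X - real n *\<^sub>R c) \<le> real n * \<delta>}"

definition gdelta :: "(int^'d \<Rightarrow> real^'d \<Rightarrow> real) \<Rightarrow> real^'d^'d \<Rightarrow> nat \<Rightarrow> real \<Rightarrow> real^'d
    \<Rightarrow> int^'d \<Rightarrow> int^'d \<Rightarrow> real" where
  "gdelta g Sig n \<delta> c J X =
     (if X \<in> Btilde Sig n \<delta> c \<and> X + J \<in> Btilde Sig n \<delta> c
      then g J (inverse (real n) *\<^sub>R rvec X) else 0)"

definition gen_A :: "(int^'d) set \<Rightarrow> (int^'d \<Rightarrow> real^'d \<Rightarrow> real) \<Rightarrow> real^'d^'d \<Rightarrow> nat \<Rightarrow> real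
    \<Rightarrow> real^'d \<Rightarrow> (int^'d \<Rightarrow> real) \<Rightarrow> int^'d \<Rightarrow> real" where
  "gen_A Js g Sig n \<delta> c h X =
     real n * (\<Sum>J\<in>Js. gdelta g Sig n \<delta> c J X * (h (X + J) - h X))"

definition Delta :: "'d \<Rightarrow> (int^'d \<Rightarrow> real) \<Rightarrow> int^'d \<Rightarrow> real" where
  "Delta j h w = h (w + ee j) - h w"

definition Delta2 :: "'d \<Rightarrow> 'd \<Rightarrow> (int^'d \<Rightarrow> real) \<Rightarrow> int^'d \<Rightarrow> real" where
  "Delta2 j k h = Delta j (Delta k h)"

definition simp_A :: "real^'d^'d \<Rightarrow> real^'d^'d \<Rightarrow> nat \<Rightarrow> real^'d \<Rightarrow> (int^'d \<Rightarrow> real)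
    \<Rightarrow> int^'d \<Rightarrow> real" where
  "simp_A sig2 A n c h w =
     real n / 2 * trace (sig2 ** (\<chi> j k. Delta2 j k h w))
     + (\<chi> j. Delta j h w) \<bullet> (A *v (rvec w - real n *\<^sub>R c))"

text \<open>Local sup-norms (maximum over an empty set is taken to be 0).\<close>
definition normD1 :: "real^'d^'d \<Rightarrow> nat \<Rightarrow> real^'d \<Rightarrow> (int^'d \<Rightarrow> real) \<Rightarrow> real \<Rightarrow> real" where
  "normD1 Sig n c h a =
     Max (insert 0 {\<bar>Delta j h X\<bar> | X j. normS Sig (rvec X - real n *\<^sub>R c) \<le> a})"

definition normD2 :: "real^'d^'d \<Rightarrow> nat \<Rightarrow> real^'d \<Rightarrow> (int^'d \<Rightarrow> real) \<Rightarrow> real \<Rightarrow> real" where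
  "normD2 Sig n c h a =
     Max (insert 0 {\<bar>Delta2 j k h X\<bar> | X j k. normS Sig (rvec X - real n *\<^sub>R c) \<le> a})"

definition dTV :: "'a pmf \<Rightarrow> 'a pmf \<Rightarrow> real" where
  "dTV p q = (SUP A. \<bar>measure_pmf.prob p A - measure_pmf.prob q A\<bar>)"

definition L0 :: "(int^'d) set \<Rightarrow> (int^'d \<Rightarrow> real^'d \<Rightarrow> real) \<Rightarrow> real^'d \<Rightarrow> real \<Rightarrow> real" where
  "L0 Js g c \<delta>0 = Max ((\<lambda>J. (SUP x\<in>cball c \<delta>0. g J x) / g J c) ` Js)"

definition L1 :: "(int^'d) set \<Rightarrow> (int^'d \<Rightarrow> real^'d \<Rightarrow> real) \<Rightarrow> (int^'d \<Rightarrow> real^'d \<Rightarrow> real^'d)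
    \<Rightarrow> real^'d \<Rightarrow> real \<Rightarrow> real" where
  "L1 Js g Dg c \<delta>0 = Max ((\<lambda>J. (SUP x\<in>cball c \<delta>0. norm (Dg J x)) / g J c) ` Js)"

definition L2 :: "(int^'d) set \<Rightarrow> (int^'d \<Rightarrow> real^'d \<Rightarrow> real) \<Rightarrow> (int^'d \<Rightarrow> real^'d \<Rightarrow> real^'d^'d)
    \<Rightarrow> real^'d \<Rightarrow> real \<Rightarrow> real" where
  "L2 Js g D2g c \<delta>0 =
     Max ((\<lambda>J. (SUP x\<in>cball c \<delta>0. onorm (\<lambda>y. D2g J x *v y)) / g J c) ` Js)"

definition Lambda_bar :: "(int^'d) set \<Rightarrow> (int^'d \<Rightarrow> real^'d \<Rightarrow> real) \<Rightarrow> real^'d \<Rightarrow> real" where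
  "Lambda_bar Js g c = trace (sigma2 Js g c) / real CARD('d)"

definition gamma_bar :: "(int^'d) set \<Rightarrow> (int^'d \<Rightarrow> real^'d \<Rightarrow> real) \<Rightarrow> real^'d \<Rightarrow> real" where
  "gamma_bar Js g c = real CARD('d) powr (-3/2) * (\<Sum>J\<in>Js. g J c * norm (rvec J) ^ 3)"

definition JSmax :: "(int^'d) set \<Rightarrow> real^'d^'d \<Rightarrow> real" where
  "JSmax Js Sig = Max ((\<lambda>J. norm (inv_sqrt Sig *v rvec J)) ` Js)"

definition sigma2S :: "real^'d^'d \<Rightarrow> real^'d^'d \<Rightarrow> real^'d^'d" where
  "sigma2S sig2 Sig = inv_sqrt Sig ** sig2 ** inv_sqrt Sig"

definition alpha1 :: "real^'d^'d \<Rightarrow> real^'d^'d \<Rightarrow> real" where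
  "alpha1 sig2 Sig = lam_min (sigma2S sig2 Sig) / 2"

definition Kstar :: "(int^'d) set \<Rightarrow> (int^'d \<Rightarrow> real^'d \<Rightarrow> real) \<Rightarrow> real^'d \<Rightarrow> real \<Rightarrow> real^'d^'d \<Rightarrow> real" where
  "Kstar Js g c \<delta>0 Sig =
     sqrt (2 * L0 Js g c \<delta>0 * trace (sigma2S (sigma2 Js g c) Sig)
           / (real CARD('d) * alpha1 (sigma2 Js g c) Sig))"

definition delta_star :: "real \<Rightarrow> real^'d^'d \<Rightarrow> real" where
  "delta_star \<delta>0 Sig = \<delta>0 / sqrt (lam_max Sig)"

definition theta1 :: "(int^'d) set \<Rightarrow> (int^'d \<Rightarrow> real^'d \<Rightarrow> real) \<Rightarrow> real^'d \<Rightarrow> real \<Rightarrow> real^'d^'d \<Rightarrow> real" where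
  "theta1 Js g c \<delta>0 Sig =
     (let d = real CARD('d); jm = JSmax Js Sig / d in
      inverse d * min (1 / (3 * jm * delta_star \<delta>0 Sig))
                   (min (1 / (64 * L0 Js g c \<delta>0 * rho (sigma2 Js g c) * rho Sig))
                        (1 / (4 * jm ^ 2))))"

definition n_star :: "(int^'d) set \<Rightarrow> real \<Rightarrow> real^'d^'d \<Rightarrow> real" where
  "n_star Js \<delta>0 Sig = (JSmax Js Sig / real CARD('d) / delta_star \<delta>0 Sig) powr (4/3)"

definition K2 :: "(int^'d) set \<Rightarrow> (int^'d \<Rightarrow> real^'d \<Rightarrow> real) \<Rightarrow> real^'d \<Rightarrow> real \<Rightarrow> real^'d^'d \<Rightarrow> real" where
  "K2 Js g c \<delta>0 Sig = L0 Js g c \<delta>0 *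
     exp (theta1 Js g c \<delta>0 Sig * (Kstar Js g c \<delta>0 Sig + JSmax Js Sig / real CARD('d)) ^ 2)"

definition n2 :: "(int^'d) set \<Rightarrow> (int^'d \<Rightarrow> real^'d \<Rightarrow> real) \<Rightarrow> real^'d \<Rightarrow> real \<Rightarrow> real^'d^'d \<Rightarrow> real \<Rightarrow> real" where
  "n2 Js g c \<delta>0 Sig T = max (K2 Js g c \<delta>0 Sig * Lambda_bar Js g c * T) (n_star Js \<delta>0 Sig)"

definition psi :: "(int^'d) set \<Rightarrow> (int^'d \<Rightarrow> real^'d \<Rightarrow> real) \<Rightarrow> real^'d \<Rightarrow> real \<Rightarrow> real^'d^'d \<Rightarrow> real \<Rightarrow> real" where
  "psi Js g c \<delta>0 Sig m =
     4 * sqrt (ln m / ((real CARD('d) * theta1 Js g c \<delta>0 Sig) * m powr (3/4)))"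

definition psi_inv :: "(int^'d) set \<Rightarrow> (int^'d \<Rightarrow> real^'d \<Rightarrow> real) \<Rightarrow> real^'d \<Rightarrow> real \<Rightarrow> real^'d^'d \<Rightarrow> real \<Rightarrow> nat" where
  "psi_inv Js g c \<delta>0 Sig \<eta> = (LEAST m::nat. 4 \<le> m \<and> psi Js g c \<delta>0 Sig (real m) \<le> \<eta>)"

definition g_low :: "(int^'d \<Rightarrow> real^'d \<Rightarrow> real) \<Rightarrow> real^'d \<Rightarrow> 'd \<Rightarrow> real" where
  "g_low g c j = g (- ee j) c"

definition I_set :: "real^'d^'d \<Rightarrow> 'd \<Rightarrow> 'd set" where
  "I_set A j = {i. A $ i $ j \<noteq> 0}"

definition G_up :: "(int^'d \<Rightarrow> real^'d \<Rightarrow> real) \<Rightarrow> real^'d \<Rightarrow> real^'d^'d \<Rightarrow> 'd \<Rightarrow> real" where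
  "G_up g c A j = (\<Sum>i\<in>I_set A j. g (ee i) c)"

definition g_star :: "(int^'d \<Rightarrow> real^'d \<Rightarrow> real) \<Rightarrow> real^'d \<Rightarrow> real^'d^'d \<Rightarrow> real" where
  "g_star g c A = Min ((\<lambda>j. min (g_low g c j) (G_up g c A j)) ` UNIV)"

definition n3 :: "(int^'d) set \<Rightarrow> (int^'d \<Rightarrow> real^'d \<Rightarrow> real) \<Rightarrow> real^'d \<Rightarrow> real \<Rightarrow> real^'d^'d
    \<Rightarrow> real^'d^'d \<Rightarrow> real" where
  "n3 Js g c \<delta>0 Sig A =
     max ((5 * (JSmax Js Sig / real CARD('d)) *
            max 1 (sqrt (real CARD('d) * theta1 Js g c \<delta>0 Sig))) powr (8/3))
         (n2 Js g c \<delta>0 Sig (1 / g_star g c A))"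

end

theory Submission
  imports Defs "HOL-Real_Asymp.Real_Asymp"
begin

text \<open>
  On the ball where the indicator is \<open>1\<close>, no jump leaves the truncation region, and the difference
  of the two operators splits into three parts: the error of linearising the drift, bounded by
  \<open>D2g\<close>; the error of freezing the jump rates at \<open>c\<close> in the second-order remainder of \<open>h\<close>, bounded
  by \<open>Dg\<close>; and the discrete second-order Taylor remainder of \<open>h\<close> with frozen rates. The last one
  is a signed sum of differences \<open>Delta2 j k h (w + y) - Delta2 j k h w\<close> along a lattice path from
  \<open>0\<close> to the jump, and the expectation of each is controlled by the total variation hypothesis, up to
  the probability of leaving the ball. The discrete Taylor polynomial contains
  \<open>(J $ j * J $ k - (if j = k then J $ j else 0)) / 2\<close> instead of \<open>J $ j * J $ k / 2\<close>; the
  correction vanishes after summation because the drift at \<open>c\<close> is zero.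

  The intermediate points of the paths are dominated by the jump in Euclidean norm only, so their
  distance in the norm of \<open>Sig\<close> may grow by the factor \<open>sqrt (rho Sig)\<close>. The second entry of the
  minimum defining \<open>theta1\<close> absorbs this factor through the condition \<open>n \<ge> psi_inv \<dots> (\<delta> / 2)\<close>.
\<close>

subsection \<open>Spectral theorem and square roots of real symmetric matrices\<close>

lemma symmetric_mat_inner:
  fixes M :: "real^'n^'n"
  assumes "symmetric_mat M"
  shows "x \<bullet> (M *v y) = (M *v x) \<bullet> y"
  using assms unfolding symmetric_mat_def
  by (metis dot_lmul_matrix vector_transpose_matrix)

lemma symmetric_mat_inner_iff:
  fixes M :: "real^'n^'n"
  shows "symmetric_mat M \<longleftrightarrow> (\<forall>x y. x \<bullet> (M *v y) = (M *v x) \<bullet> y)"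
proof
  assume *: "\<forall>x y. x \<bullet> (M *v y) = (M *v x) \<bullet> y"
  have "transpose M *v x = M *v x" for x
  proof (rule vector_eq_ldot[THEN iffD1], intro allI)
    fix y
    show "y \<bullet> (transpose M *v x) = y \<bullet> (M *v x)"
      using * by (metis dot_lmul_matrix inner_commute vector_transpose_matrix transpose_transpose)
  qed
  then show "symmetric_mat M"
    by (simp add: symmetric_mat_def matrix_eq)
qed (simp add: symmetric_mat_inner)

text \<open>Maximise the Rayleigh quotient on the unit sphere of \<open>V\<close>: unless the
  residual of the eigenvalue equation vanishes at a maximiser, it is a direction of increase. An
  invariant subspace is allowed because the lemma is applied to the orthogonal complement of
  eigenvectors already found.\<close>

lemma symmetric_mat_eigenvector_exists:
  fixes M :: "real^'n^'n"
  assumes sym: "symmetric_mat M" and V: "subspace V" and inv: "\<And>x. x \<in> V \<Longrightarrow> M *v x \<in> V"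
    and ne: "\<exists>x\<in>V. x \<noteq> 0"
  obtains u \<mu> where "u \<in> V" "norm u = 1" "M *v u = \<mu> *\<^sub>R u"
proof -
  let ?K = "V \<inter> sphere 0 1"
  have "compact ?K"
    by (metis V closed_subspace closed_Int_compact compact_sphere)
  moreover have "?K \<noteq> {}"
  proof -
    obtain x where x: "x \<in> V" "x \<noteq> 0" using ne by blast
    then have "x /\<^sub>R norm x \<in> ?K"
      using V by (simp add: subspace_scale)
    then show ?thesis by blast
  qed
  moreover have "continuous_on ?K (\<lambda>x. x \<bullet> (M *v x))"
    by (intro continuous_intros linear_continuous_on) (simp add: linear_linear)
  ultimately have "\<exists>u\<in>?K. \<forall>x\<in>?K. x \<bullet> (M *v x) \<le> u \<bullet> (M *v u)"
    by (rule continuous_attains_sup)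
  then obtain u where u: "u \<in> ?K" and umax: "\<And>x. x \<in> ?K \<Longrightarrow> x \<bullet> (M *v x) \<le> u \<bullet> (M *v u)"
    by blast
  define \<mu> where "\<mu> = u \<bullet> (M *v u)"
  have uu: "u \<bullet> u = 1" using u by (simp add: dot_square_norm)
  have max: "x \<bullet> (M *v x) \<le> \<mu> * (x \<bullet> x)" if "x \<in> V" for x
  proof (cases "x = 0")
    case False
    then have "x /\<^sub>R norm x \<in> ?K" using that V by (simp add: subspace_scale)
    then have "(x /\<^sub>R norm x) \<bullet> (M *v (x /\<^sub>R norm x)) \<le> \<mu>"
      using umax \<mu>_def by blast
    then have "(x \<bullet> (M *v x)) / (norm x)\<^sup>2 \<le> \<mu>"
      by (simp add: matrix_vector_mult_scaleR divide_inverse power2_eq_square mult.commute mult.left_commute)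
    then show ?thesis using False
      by (simp add: dot_square_norm divide_le_eq)
  qed simp
  define z where "z = M *v u - \<mu> *\<^sub>R u"
  have zV: "z \<in> V" using u inv V unfolding z_def by (simp add: subspace_diff subspace_scale)
  define b where "b = z \<bullet> (M *v z) - \<mu> * (z \<bullet> z)"
  \<comment> \<open>Maximality of \<open>\<mu>\<close>, tested at \<open>u + t *\<^sub>R z\<close>;
    the coefficient linear in \<open>t\<close> is twice \<open>z \<bullet> z\<close>.\<close>
  have *: "2 * t * (z \<bullet> z) + t\<^sup>2 * b \<le> 0" for t
  proof -
    have "u + t *\<^sub>R z \<in> V" using u zV V by (simp add: subspace_add subspace_scale)
    note max[OF this]
    moreover have "(u + t *\<^sub>R z) \<bullet> (M *v (u + t *\<^sub>R z))
        = \<mu> + 2 * t * (z \<bullet> (M *v u)) + t\<^sup>2 * (z \<bullet> (M *v z))"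
      using symmetric_mat_inner[OF sym, of u z]
      by (simp add: matrix_vector_right_distrib matrix_vector_mult_scaleR inner_add \<mu>_def
          power2_eq_square algebra_simps inner_commute)
    moreover have "(u + t *\<^sub>R z) \<bullet> (u + t *\<^sub>R z) = 1 + 2 * t * (z \<bullet> u) + t\<^sup>2 * (z \<bullet> z)"
      using uu by (simp add: inner_add power2_eq_square algebra_simps inner_commute)
    moreover have "z \<bullet> z = z \<bullet> (M *v u) - \<mu> * (z \<bullet> u)"
      by (subst (2) z_def) (simp add: inner_diff)
    moreover have "2 * t * s + t\<^sup>2 * (w - \<mu> * s) \<le> 0"
      if "L \<le> \<mu> * R" "L = \<mu> + 2 * t * p + t\<^sup>2 * w" "R = 1 + 2 * t * q + t\<^sup>2 * s" "s = p - \<mu> * q"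
      for L R p q s w :: real
    proof -
      have "2 * t * s + t\<^sup>2 * (w - \<mu> * s) = L - \<mu> * R" using that(2-4) by algebra
      then show ?thesis using that(1) by simp
    qed
    ultimately show ?thesis unfolding b_def by blast
  qed
  have "z \<bullet> z = 0"
  proof (rule ccontr)
    assume "z \<bullet> z \<noteq> 0"
    then have pos: "z \<bullet> z > 0" by (simp add: order_less_le)
    \<comment> \<open>Chosen so small that the term linear in \<open>t\<close> outweighs the
      quadratic one.\<close>
    define t where "t = (z \<bullet> z) / (\<bar>b\<bar> + 1)"
    have t: "t > 0" using pos by (simp add: t_def)
    have "t * \<bar>b\<bar> \<le> z \<bullet> z" using pos by (simp add: t_def field_simps)
    then have "- (t * b) \<le> z \<bullet> z" using t
      by (smt (verit) mult_less_cancel_left_pos mult_minus_right abs_ge_minus_self)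
    then have "0 < 2 * (z \<bullet> z) + t * b" using pos by linarith
    then have "0 < t * (2 * (z \<bullet> z) + t * b)" using t by simp
    then show False using *[of t] by (simp add: power2_eq_square algebra_simps)
  qed
  then have "M *v u = \<mu> *\<^sub>R u" by (simp add: z_def)
  then show thesis using that[of u \<mu>] u by simp
qed

lemma inner_self_orthonormal_expansion:
  assumes "x = (\<Sum>b\<in>B. (b \<bullet> x) *\<^sub>R b)"
  shows "x \<bullet> y = (\<Sum>b\<in>B. (b \<bullet> x) * (b \<bullet> y))"
  by (subst assms) (simp add: inner_sum_left)

text \<open>Completeness is expressed by the expansion \<open>expand\<close> instead of a count of
  vectors: inner products and quadratic forms then reduce to finite sums over \<open>B\<close>,
  without any indexing of the basis.\<close>

locale orthonormal_eigenbasis =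
  fixes M :: "real^'n^'n" and B :: "(real^'n) set" and \<mu> :: "real^'n \<Rightarrow> real"
  assumes finB: "finite B"
    and ortho: "\<And>a b. a \<in> B \<Longrightarrow> b \<in> B \<Longrightarrow> a \<bullet> b = (if a = b then 1 else 0)"
    and eig: "\<And>b. b \<in> B \<Longrightarrow> M *v b = \<mu> b *\<^sub>R b"
    and expand: "\<And>x. x = (\<Sum>b\<in>B. (b \<bullet> x) *\<^sub>R b)"
    and sym: "symmetric_mat M"
begin

lemma inner_expand: "x \<bullet> y = (\<Sum>b\<in>B. (b \<bullet> x) * (b \<bullet> y))"
  by (rule inner_self_orthonormal_expansion[OF expand])

lemma inner_mult: "b \<in> B \<Longrightarrow> b \<bullet> (M *v x) = \<mu> b * (b \<bullet> x)"
  using symmetric_mat_inner[OF sym, of b x] eig by simp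

lemma B_nonzero: "b \<in> B \<Longrightarrow> b \<noteq> 0"
  using ortho by force

lemma B_nonempty: "B \<noteq> {}"
proof
  assume "B = {}"
  then have "(1::real^'n) = 0" using expand[of 1] by simp
  then show False by simp
qed

lemma expand_nonzero:
  assumes "x \<noteq> 0"
  shows "\<exists>b\<in>B. b \<bullet> x \<noteq> 0"
proof (rule ccontr)
  assume "\<not> ?thesis"
  then have "(\<Sum>b\<in>B. (b \<bullet> x) *\<^sub>R b) = 0" by (intro sum.neutral) simp
  then show False using expand[of x] assms by simp
qed

text \<open>An eigenvector has a nonzero coefficient at some \<open>b\<close>, and comparing that
  coefficient forces its eigenvalue to be \<open>\<mu> b\<close>. Hence \<open>lam_min\<close> and
  \<open>lam_max\<close> are extrema of a finite nonempty set.\<close>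

lemma real_eigenvalues_eq: "real_eigenvalues M = \<mu> ` B"
proof
  show "\<mu> ` B \<subseteq> real_eigenvalues M"
    using eig B_nonzero by (auto simp: real_eigenvalues_def)
  show "real_eigenvalues M \<subseteq> \<mu> ` B"
  proof
    fix m assume "m \<in> real_eigenvalues M"
    then obtain v where v: "v \<noteq> 0" "M *v v = m *\<^sub>R v" by (auto simp: real_eigenvalues_def)
    then obtain b where b: "b \<in> B" "b \<bullet> v \<noteq> 0" using expand_nonzero by blast
    then have "m = \<mu> b" using inner_mult[of b v] v by simp
    then show "m \<in> \<mu> ` B" using b by blast
  qed
qed

lemma lam_bounds: "b \<in> B \<Longrightarrow> lam_min M \<le> \<mu> b" "b \<in> B \<Longrightarrow> \<mu> b \<le> lam_max M"
  using finB by (auto simp: lam_min_def lam_max_def real_eigenvalues_eq)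

lemma lam_min_le_max: "lam_min M \<le> lam_max M"
  using lam_bounds B_nonempty by (meson all_not_in_conv order_trans)

lemma pos_def_pos: "pos_def M \<Longrightarrow> b \<in> B \<Longrightarrow> 0 < \<mu> b"
  using eig[of b] ortho[of b b] B_nonzero[of b] by (auto simp: pos_def_def)

lemma lam_min_pos:
  assumes "pos_def M"
  shows "0 < lam_min M"
proof -
  have "lam_min M \<in> \<mu> ` B"
    unfolding lam_min_def real_eigenvalues_eq using finB B_nonempty by (intro Min_in) auto
  then show ?thesis using pos_def_pos assms by auto
qed

text \<open>For \<open>x = matrix_inv M *v Y\<close> the two sides become the squared Euclidean norm
  of \<open>Y\<close> and \<open>lam_max M\<close> times its squared \<open>normS\<close>. This form
  avoids the spectrum of the inverse.\<close>

lemma norm_le_lam_max: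
  assumes "pos_def M"
  shows "(norm (M *v x))\<^sup>2 \<le> lam_max M * (x \<bullet> (M *v x))"
proof -
  have "(norm (M *v x))\<^sup>2 = (\<Sum>b\<in>B. (\<mu> b * (b \<bullet> x)) * (\<mu> b * (b \<bullet> x)))"
    by (simp only: dot_square_norm[symmetric], subst inner_expand) (simp add: inner_mult)
  also have "\<dots> \<le> (\<Sum>b\<in>B. lam_max M * ((b \<bullet> x) * (\<mu> b * (b \<bullet> x))))"
  proof (rule sum_mono)
    fix b assume b: "b \<in> B"
    have "\<mu> b * (\<mu> b * (b \<bullet> x)\<^sup>2) \<le> lam_max M * (\<mu> b * (b \<bullet> x)\<^sup>2)"
      using lam_bounds(2)[OF b] pos_def_pos[OF assms b] by (intro mult_right_mono) auto
    then show "(\<mu> b * (b \<bullet> x)) * (\<mu> b * (b \<bullet> x)) \<le> lam_max M * ((b \<bullet> x) * (\<mu> b * (b \<bullet> x)))"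
      by (simp add: power2_eq_square algebra_simps)
  qed
  also have "\<dots> = lam_max M * (x \<bullet> (M *v x))"
    by (subst inner_expand) (simp add: inner_mult sum_distrib_left)
  finally show ?thesis .
qed

lemma lam_min_le_norm:
  assumes "pos_def M"
  shows "lam_min M * (x \<bullet> (M *v x)) \<le> (norm (M *v x))\<^sup>2"
proof -
  have "lam_min M * (x \<bullet> (M *v x)) = (\<Sum>b\<in>B. lam_min M * ((b \<bullet> x) * (\<mu> b * (b \<bullet> x))))"
    by (subst inner_expand) (simp add: inner_mult sum_distrib_left)
  also have "\<dots> \<le> (\<Sum>b\<in>B. (\<mu> b * (b \<bullet> x)) * (\<mu> b * (b \<bullet> x)))"
  proof (rule sum_mono)
    fix b assume b: "b \<in> B"
    have "lam_min M * (\<mu> b * (b \<bullet> x)\<^sup>2) \<le> \<mu> b * (\<mu> b * (b \<bullet> x)\<^sup>2)"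
      using lam_bounds(1)[OF b] pos_def_pos[OF assms b] by (intro mult_right_mono) auto
    then show "lam_min M * ((b \<bullet> x) * (\<mu> b * (b \<bullet> x))) \<le> (\<mu> b * (b \<bullet> x)) * (\<mu> b * (b \<bullet> x))"
      by (simp add: power2_eq_square algebra_simps)
  qed
  also have "\<dots> = (norm (M *v x))\<^sup>2"
    by (simp only: dot_square_norm[symmetric], subst inner_expand) (simp add: inner_mult)
  finally show ?thesis .
qed

text \<open>The root stretches each eigendirection by the square root of its eigenvalue.\<close>

lemma sqrt_exists:
  assumes "pos_def M"
  shows "\<exists>S. symmetric_mat S \<and> pos_def S \<and> S ** S = M"
proof -
  define f where "f x = (\<Sum>b\<in>B. (sqrt (\<mu> b) * (b \<bullet> x)) *\<^sub>R b)" for x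
  have lin: "linear f"
    by (rule linearI) (simp_all add: f_def inner_add algebra_simps sum.distrib scaleR_sum_right)
  define S where "S = matrix f"
  have S: "S *v x = f x" for x
    using lin by (simp add: S_def)
  have bf: "b \<bullet> f x = sqrt (\<mu> b) * (b \<bullet> x)" if "b \<in> B" for b x
  proof -
    have "b \<bullet> f x = (\<Sum>a\<in>B. sqrt (\<mu> a) * (a \<bullet> x) * (b \<bullet> a))"
      by (simp add: f_def inner_sum_right)
    also have "\<dots> = (\<Sum>a\<in>B. if a = b then sqrt (\<mu> b) * (b \<bullet> x) else 0)"
      by (rule sum.cong) (use ortho that in auto)
    finally show ?thesis using that finB by simp
  qed
  have "symmetric_mat S"
    unfolding symmetric_mat_inner_iff S
  proof (intro allI)
    fix x y
    show "x \<bullet> f y = f x \<bullet> y"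
      by (subst (1 2) inner_expand) (simp add: bf algebra_simps)
  qed
  moreover have "pos_def S"
    unfolding pos_def_def S
  proof (intro allI impI)
    fix x :: "real^'n" assume "x \<noteq> 0"
    then obtain b where b: "b \<in> B" "b \<bullet> x \<noteq> 0"
      using expand_nonzero by blast
    have "x \<bullet> f x = (\<Sum>b\<in>B. sqrt (\<mu> b) * (b \<bullet> x)\<^sup>2)"
      by (subst inner_expand) (simp add: bf power2_eq_square algebra_simps)
    also have "\<dots> > 0"
    proof (rule sum_pos2[OF finB b(1)])
      show "0 < sqrt (\<mu> b) * (b \<bullet> x)\<^sup>2"
        using pos_def_pos[OF assms b(1)] b by simp
      show "0 \<le> sqrt (\<mu> a) * (a \<bullet> x)\<^sup>2" if "a \<in> B" for a
        using pos_def_pos[OF assms that] by simp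
    qed
    finally show "x \<bullet> f x > 0" .
  qed
  moreover have "S ** S = M"
    unfolding matrix_eq matrix_vector_mul_assoc[symmetric] S
  proof
    fix x
    have "M *v x = (\<Sum>b\<in>B. (b \<bullet> (M *v x)) *\<^sub>R b)" by (rule expand)
    also have "\<dots> = (\<Sum>b\<in>B. (sqrt (\<mu> b) * (b \<bullet> f x)) *\<^sub>R b)"
    proof (rule sum.cong)
      fix b assume b: "b \<in> B"
      have "sqrt (\<mu> b) * sqrt (\<mu> b) = \<mu> b" using pos_def_pos[OF assms b] by simp
      then show "(b \<bullet> (M *v x)) *\<^sub>R b = (sqrt (\<mu> b) * (b \<bullet> f x)) *\<^sub>R b"
        using b by (simp add: bf inner_mult mult.assoc[symmetric])
    qed simp
    finally show "f (f x) = M *v x" by (simp add: f_def)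
  qed
  ultimately show ?thesis by blast
qed

end

text \<open>The dimension bounds the size of orthonormal families of eigenvectors, so a largest one
  exists. It is complete: its orthogonal complement is invariant by symmetry, and a nonzero vector
  there would supply one more eigenvector.\<close>

theorem symmetric_mat_eigenbasis:
  fixes M :: "real^'n^'n"
  assumes sym: "symmetric_mat M"
  obtains B \<mu> where "orthonormal_eigenbasis M B \<mu>"
proof -
  define P where "P B \<longleftrightarrow> (\<forall>a\<in>B. \<forall>b\<in>B. a \<bullet> b = (if a = b then 1 else 0))
    \<and> (\<forall>b\<in>B. \<exists>m. M *v b = m *\<^sub>R b)" for B
  have PB: "finite B \<and> card B \<le> DIM(real^'n)" if "P B" for B
  proof -
    have "pairwise orthogonal B" using that by (auto simp: P_def pairwise_def orthogonal_def)
    moreover have "0 \<notin> B" using that by (force simp: P_def)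
    ultimately show ?thesis
      using pairwise_orthogonal_independent independent_bound by blast
  qed
  have "\<exists>B. P B \<and> (\<forall>C. P C \<longrightarrow> card C \<le> card B)"
  proof (rule ex_has_greatest_nat[where P = P and f = card])
    show "P {}" by (simp add: P_def)
    show "\<forall>C. P C \<longrightarrow> card C < Suc DIM(real^'n)" using PB by (metis less_Suc_eq_le)
  qed
  then obtain B where B: "P B" and Bmax: "\<And>C. P C \<Longrightarrow> card C \<le> card B" by blast
  have fin: "finite B" using B PB by blast
  define V where "V = {x. \<forall>b\<in>B. b \<bullet> x = 0}"
  have V: "subspace V" by (auto simp: V_def subspace_def inner_add)
  have V0: "x = 0" if "x \<in> V" for x
  proof (rule ccontr)
    assume "x \<noteq> 0"
    then have ne: "\<exists>x\<in>V. x \<noteq> 0" using that by blast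
    have inv: "M *v y \<in> V" if "y \<in> V" for y
      using that B symmetric_mat_inner[OF sym] by (force simp: V_def P_def)
    obtain u m where u: "u \<in> V" "norm u = 1" "M *v u = m *\<^sub>R u"
      by (rule symmetric_mat_eigenvector_exists[OF sym V inv ne])
    have "u \<bullet> u = 1" using u by (simp add: dot_square_norm)
    moreover have "u \<notin> B" using u \<open>u \<bullet> u = 1\<close> by (auto simp: V_def)
    moreover have "u \<bullet> b = 0" "b \<bullet> u = 0" if "b \<in> B" for b
      using u that by (auto simp: V_def inner_commute)
    ultimately have "P (insert u B)" using B u by (auto simp: P_def)
    from Bmax[OF this] show False using \<open>u \<notin> B\<close> fin by simp
  qed
  have exp: "x = (\<Sum>b\<in>B. (b \<bullet> x) *\<^sub>R b)" for x
  proof -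
    have "b \<bullet> (\<Sum>a\<in>B. (a \<bullet> x) *\<^sub>R a) = b \<bullet> x" if "b \<in> B" for b
    proof -
      have "b \<bullet> (\<Sum>a\<in>B. (a \<bullet> x) *\<^sub>R a) = (\<Sum>a\<in>B. (a \<bullet> x) * (b \<bullet> a))"
        by (simp add: inner_sum_right)
      also have "\<dots> = (\<Sum>a\<in>B. if a = b then b \<bullet> x else 0)"
        by (rule sum.cong) (use B that in \<open>auto simp: P_def\<close>)
      finally show ?thesis using that fin by simp
    qed
    then have "x - (\<Sum>b\<in>B. (b \<bullet> x) *\<^sub>R b) \<in> V" by (simp add: V_def inner_diff)
    then show ?thesis using V0 by fastforce
  qed
  have ortho: "a \<bullet> b = (if a = b then 1 else 0)" if "a \<in> B" "b \<in> B" for a b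
    using B that unfolding P_def by blast
  have "\<forall>b\<in>B. \<exists>m. M *v b = m *\<^sub>R b" using B unfolding P_def by blast
  from bchoice[OF this] obtain \<mu> where "\<forall>b\<in>B. M *v b = \<mu> b *\<^sub>R b" ..
  then have "M *v b = \<mu> b *\<^sub>R b" if "b \<in> B" for b using that by blast
  then have "orthonormal_eigenbasis M B \<mu>"
    using fin ortho exp sym by (intro orthonormal_eigenbasis.intro)
  with that show thesis .
qed

text \<open>Equal squares give \<open>S ** D + D ** T = 0\<close> for the difference
  \<open>D\<close>. Tested on an eigenvector of \<open>D\<close>, this says that its eigenvalue
  times a positive number is zero. Uniqueness makes the \<open>THE\<close> in \<open>msqrt\<close>
  denote the root.\<close>

lemma pos_def_sqrt_unique:
  fixes S T :: "real^'n^'n"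
  assumes S: "symmetric_mat S" "pos_def S" and T: "symmetric_mat T" "pos_def T"
    and eq: "S ** S = T ** T"
  shows "S = T"
proof -
  define D where "D = S - T"
  have Dx: "D *v x = S *v x - T *v x" for x by (simp add: D_def matrix_vector_mult_diff_rdistrib)
  have symD: "symmetric_mat D"
    using symmetric_mat_inner[OF S(1)] symmetric_mat_inner[OF T(1)]
    by (simp add: symmetric_mat_inner_iff Dx inner_diff)
  have z: "S *v (D *v x) + D *v (T *v x) = 0" for x
    unfolding Dx matrix_vector_mult_diff_distrib by (simp add: matrix_vector_mul_assoc eq)
  obtain B \<mu> where "orthonormal_eigenbasis D B \<mu>" using symmetric_mat_eigenbasis[OF symD] .
  then interpret orthonormal_eigenbasis D B \<mu> .
  have "\<mu> b = 0" if b: "b \<in> B" for b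
  proof -
    have "b \<bullet> (S *v (D *v b)) + (D *v b) \<bullet> (T *v b) = 0"
      using z[of b] symmetric_mat_inner[OF symD, of b "T *v b"] by (metis inner_add_right inner_zero_right)
    then have "\<mu> b * (b \<bullet> (S *v b) + b \<bullet> (T *v b)) = 0"
      by (simp add: eig[OF b] matrix_vector_mult_scaleR algebra_simps)
    moreover have "b \<bullet> (S *v b) + b \<bullet> (T *v b) > 0"
      using S(2) T(2) B_nonzero[OF b] by (simp add: pos_def_def add_pos_pos)
    ultimately show ?thesis by simp
  qed
  then have "D *v x = 0" for x
    using expand[of "D *v x"] by (simp add: inner_mult)
  then show ?thesis by (simp add: Dx matrix_eq)
qed

lemma msqrt_props:
  fixes M :: "real^'n^'n"
  assumes "symmetric_mat M" "pos_def M"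
  shows "symmetric_mat (msqrt M)" "pos_def (msqrt M)" "msqrt M ** msqrt M = M"
proof -
  obtain B \<mu> where "orthonormal_eigenbasis M B \<mu>" using symmetric_mat_eigenbasis[OF assms(1)] .
  from orthonormal_eigenbasis.sqrt_exists[OF this assms(2)]
  have "\<exists>!S. symmetric_mat S \<and> pos_def S \<and> S ** S = M"
    using pos_def_sqrt_unique by metis
  from theI'[OF this]
  show "symmetric_mat (msqrt M)" "pos_def (msqrt M)" "msqrt M ** msqrt M = M"
    by (simp_all add: msqrt_def)
qed

lemma pos_def_invertible:
  fixes M :: "real^'n^'n"
  assumes "pos_def M"
  shows "invertible M"
  unfolding invertible_left_inverse matrix_left_invertible_injective
proof (rule injI)
  fix x y assume "M *v x = M *v y"
  then have "(x - y) \<bullet> (M *v (x - y)) = 0" by (simp add: matrix_vector_mult_diff_distrib)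
  then have "x - y = 0" using assms unfolding pos_def_def by (metis less_irrefl)
  then show "x = y" by simp
qed

lemma pos_def_matrix_inv:
  fixes M :: "real^'n^'n"
  assumes "pos_def M"
  shows "M *v (matrix_inv M *v x) = x" "matrix_inv M *v (M *v x) = x"
proof -
  have "\<exists>M'. M ** M' = mat 1 \<and> M' ** M = mat 1"
    using pos_def_invertible[OF assms] by (simp add: invertible_def)
  from someI_ex[OF this] have "M ** matrix_inv M = mat 1" "matrix_inv M ** M = mat 1"
    by (simp_all add: matrix_inv_def)
  then show "M *v (matrix_inv M *v x) = x" "matrix_inv M *v (M *v x) = x"
    by (simp_all add: matrix_vector_mul_assoc)
qed

text \<open>As the Euclidean norm of a linear image, \<open>normS\<close> inherits the triangle
  inequality and becomes comparable with \<open>JSmax\<close>, which is defined through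
  \<open>inv_sqrt\<close>.\<close>

lemma normS_eq_norm_inv_sqrt:
  fixes Sig :: "real^'n^'n"
  assumes "symmetric_mat Sig" "pos_def Sig"
  shows "normS Sig Y = norm (inv_sqrt Sig *v Y)"
proof -
  let ?S = "msqrt Sig"
  note S = msqrt_props[OF assms]
  define u where "u = matrix_inv ?S *v Y"
  define x where "x = matrix_inv Sig *v Y"
  have "Sig *v x = Y" using pos_def_matrix_inv[OF assms(2)] by (simp add: x_def)
  then have "?S *v (?S *v x) = Y" by (simp add: matrix_vector_mul_assoc S)
  then have u: "u = ?S *v x" by (metis pos_def_matrix_inv(2)[OF S(2)] u_def)
  then have "?S *v u = Y" using \<open>?S *v (?S *v x) = Y\<close> by simp
  then have "Y \<bullet> x = u \<bullet> u" using symmetric_mat_inner[OF S(1), of u x] u by simp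
  then show ?thesis by (simp add: normS_def inv_sqrt_def x_def u_def norm_eq_sqrt_inner)
qed

lemma normS_triangle:
  fixes Sig :: "real^'n^'n"
  assumes "symmetric_mat Sig" "pos_def Sig"
  shows "normS Sig (x + y) \<le> normS Sig x + normS Sig y"
  by (simp add: normS_eq_norm_inv_sqrt[OF assms] matrix_vector_right_distrib norm_triangle_ineq)

lemma normS_nonneg:
  fixes Sig :: "real^'n^'n"
  assumes "symmetric_mat Sig" "pos_def Sig"
  shows "0 \<le> normS Sig x"
  by (simp add: normS_eq_norm_inv_sqrt[OF assms])

lemma normS_square:
  fixes Sig :: "real^'n^'n"
  assumes "symmetric_mat Sig" "pos_def Sig"
  shows "(normS Sig Y)\<^sup>2 = (matrix_inv Sig *v Y) \<bullet> (Sig *v (matrix_inv Sig *v Y))"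
proof -
  have "0 \<le> Y \<bullet> (matrix_inv Sig *v Y)"
    using normS_nonneg[OF assms, of Y] by (simp add: normS_def)
  then show ?thesis
    by (simp add: normS_def pos_def_matrix_inv[OF assms(2)] inner_commute)
qed

lemma lam_pos:
  fixes M :: "real^'n^'n"
  assumes "symmetric_mat M" "pos_def M"
  shows "0 < lam_min M" "lam_min M \<le> lam_max M" "0 < lam_max M" "1 \<le> rho M"
proof -
  obtain B \<mu> where "orthonormal_eigenbasis M B \<mu>" using symmetric_mat_eigenbasis[OF assms(1)] .
  then interpret orthonormal_eigenbasis M B \<mu> .
  show "0 < lam_min M" "lam_min M \<le> lam_max M"
    using lam_min_pos[OF assms(2)] lam_min_le_max by auto
  then show "0 < lam_max M" "1 \<le> rho M" by (auto simp: rho_def)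
qed

lemma norm_le_normS:
  fixes Sig :: "real^'n^'n"
  assumes "symmetric_mat Sig" "pos_def Sig"
  shows "(norm Y)\<^sup>2 \<le> lam_max Sig * (normS Sig Y)\<^sup>2"
proof -
  obtain B \<mu> where "orthonormal_eigenbasis Sig B \<mu>" using symmetric_mat_eigenbasis[OF assms(1)] .
  from orthonormal_eigenbasis.norm_le_lam_max[OF this assms(2), of "matrix_inv Sig *v Y"]
  show ?thesis by (simp add: normS_square[OF assms] pos_def_matrix_inv[OF assms(2)])
qed

lemma normS_le_norm:
  fixes Sig :: "real^'n^'n"
  assumes "symmetric_mat Sig" "pos_def Sig"
  shows "lam_min Sig * (normS Sig Y)\<^sup>2 \<le> (norm Y)\<^sup>2"
proof -
  obtain B \<mu> where "orthonormal_eigenbasis Sig B \<mu>" using symmetric_mat_eigenbasis[OF assms(1)] .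
  from orthonormal_eigenbasis.lam_min_le_norm[OF this assms(2), of "matrix_inv Sig *v Y"]
  show ?thesis by (simp add: normS_square[OF assms] pos_def_matrix_inv[OF assms(2)])
qed

text \<open>Passing to the Euclidean norm and back costs \<open>lam_max Sig / lam_min Sig\<close> in
  the squares. It transfers the Euclidean domination of path points by a jump to
  \<open>normS\<close>.\<close>

lemma normS_le_of_norm_le:
  fixes Sig :: "real^'n^'n"
  assumes "symmetric_mat Sig" "pos_def Sig" "norm x \<le> norm y"
  shows "normS Sig x \<le> sqrt (rho Sig) * normS Sig y"
proof (rule power2_le_imp_le)
  note lam = lam_pos[OF assms(1,2)]
  have "lam_min Sig * (normS Sig x)\<^sup>2 \<le> (norm x)\<^sup>2" by (rule normS_le_norm[OF assms(1,2)])
  also have "\<dots> \<le> (norm y)\<^sup>2" using assms(3) by (simp add: power_mono)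
  also have "\<dots> \<le> lam_max Sig * (normS Sig y)\<^sup>2" by (rule norm_le_normS[OF assms(1,2)])
  finally have "(normS Sig x)\<^sup>2 \<le> lam_max Sig / lam_min Sig * (normS Sig y)\<^sup>2"
    using lam by (simp add: field_simps)
  then show "(normS Sig x)\<^sup>2 \<le> (sqrt (rho Sig) * normS Sig y)\<^sup>2"
    using lam by (simp add: rho_def power_mult_distrib)
qed (use lam_pos[OF assms(1,2)] normS_nonneg[OF assms(1,2)] in simp)

subsection \<open>Discrete Taylor expansion on the integer lattice\<close>

text \<open>The number of unit steps on a shortest lattice path from \<open>0\<close> to
  \<open>y\<close>, taken as a real number since it enters the error bounds.\<close>

definition l1 :: "int^'d \<Rightarrow> real" where
  "l1 y = (\<Sum>i\<in>UNIV. \<bar>real_of_int (y $ i)\<bar>)"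

definition coord_sum :: "int^'d \<Rightarrow> real" where
  "coord_sum y = (\<Sum>i\<in>UNIV. real_of_int (y $ i))"

lemma l1_nonneg: "0 \<le> l1 y"
  by (simp add: l1_def sum_nonneg)

lemma l1_zero [simp]: "l1 0 = 0"
  by (simp add: l1_def)

lemma coord_sum_zero [simp]: "coord_sum 0 = 0"
  by (simp add: coord_sum_def)

lemma coord_sum_ge: "- coord_sum y \<le> l1 y"
  unfolding l1_def coord_sum_def sum_negf[symmetric] by (rule sum_mono) simp

lemma sum_add_ee:
  fixes y :: "int^'d" and f :: "'d \<Rightarrow> real"
  shows "(\<Sum>i\<in>UNIV. real_of_int ((y + ee j) $ i) * f i) = (\<Sum>i\<in>UNIV. real_of_int (y $ i) * f i) + f j"
proof -
  have "(\<Sum>i\<in>UNIV. real_of_int ((y + ee j) $ i) * f i)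
      = (\<Sum>i\<in>UNIV. real_of_int (y $ i) * f i + (if i = j then f j else 0))"
    by (rule sum.cong) (auto simp: ee_def axis_def algebra_simps)
  then show ?thesis by (simp add: sum.distrib)
qed

lemma coord_sum_add: "coord_sum (y + ee j) = coord_sum y + 1"
  using sum_add_ee[of y j "\<lambda>_. 1"] by (simp add: coord_sum_def)

lemma coord_sum_diff: "coord_sum (y - ee j) = coord_sum y - 1"
  using coord_sum_add[of "y - ee j" j] by simp

lemma l1_add:
  assumes "0 \<le> y $ j"
  shows "l1 (y + ee j) = l1 y + 1"
proof -
  have "l1 (y + ee j) = (\<Sum>i\<in>UNIV. \<bar>real_of_int (y $ i)\<bar> + (if i = j then 1 else 0))"
    unfolding l1_def by (rule sum.cong) (use assms in \<open>auto simp: ee_def axis_def\<close>)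
  then show ?thesis by (simp add: sum.distrib l1_def)
qed

lemma l1_diff:
  assumes "y $ j \<le> 0"
  shows "l1 (y - ee j) = l1 y + 1"
proof -
  have "l1 (y - ee j) = (\<Sum>i\<in>UNIV. \<bar>real_of_int (y $ i)\<bar> + (if i = j then 1 else 0))"
    unfolding l1_def by (rule sum.cong) (use assms in \<open>auto simp: ee_def axis_def\<close>)
  then show ?thesis by (simp add: sum.distrib l1_def)
qed

lemma norm_rvec_add:
  assumes "0 \<le> y $ j"
  shows "norm (rvec y) \<le> norm (rvec (y + ee j))"
  by (rule norm_le_componentwise_cart) (use assms in \<open>auto simp: rvec_def ee_def axis_def\<close>)

lemma norm_rvec_diff:
  assumes "y $ j \<le> 0"
  shows "norm (rvec y) \<le> norm (rvec (y - ee j))"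
  by (rule norm_le_componentwise_cart) (use assms in \<open>auto simp: rvec_def ee_def axis_def\<close>)

text \<open>Induction on \<open>l1\<close>, along paths whose steps all lead away from the origin.
  By the sign conditions each step raises \<open>l1\<close> by exactly one and does not decrease the
  Euclidean norm, so a radius that contains the endpoint contains every earlier point.\<close>

lemma lattice_induct [case_names zero add diff]:
  fixes J :: "int^'d"
  assumes zero: "P 0"
    and add: "\<And>y j. P y \<Longrightarrow> 0 \<le> y $ j \<Longrightarrow> P (y + ee j)"
    and diff: "\<And>y j. P y \<Longrightarrow> y $ j \<le> 0 \<Longrightarrow> P (y - ee j)"
  shows "P J"
proof -
  have "\<forall>J. l1 J = real k \<longrightarrow> P J" for k
  proof (induction k)
    case 0
    have "J = 0" if "l1 J = 0" for J :: "int^'d"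
      using that unfolding l1_def by (subst (asm) sum_nonneg_eq_0_iff) (auto simp: vec_eq_iff)
    then show ?case using zero by auto
  next
    case (Suc k)
    show ?case
    proof (intro allI impI)
      fix J :: "int^'d" assume J: "l1 J = real (Suc k)"
      then have "J \<noteq> 0" by auto
      then obtain j where "J $ j \<noteq> 0" by (auto simp: vec_eq_iff)
      then consider "J $ j > 0" | "J $ j < 0" by linarith
      then show "P J"
      proof cases
        case 1
        then have *: "0 \<le> (J - ee j) $ j" by (simp add: ee_def axis_def)
        then have "P (J - ee j)" using l1_add[OF *] J Suc.IH by simp
        from add[OF this *] show ?thesis by simp
      next
        case 2
        then have *: "(J + ee j) $ j \<le> 0" by (simp add: ee_def axis_def)
        then have "P (J + ee j)" using l1_diff[OF *] J Suc.IH by simp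
        from diff[OF this *] show ?thesis by simp
      qed
    qed
  qed
  moreover have "\<exists>k. l1 J = real k"
  proof
    show "l1 J = real (\<Sum>i\<in>UNIV. nat \<bar>J $ i\<bar>)" by (simp add: l1_def)
  qed
  ultimately show ?thesis by blast
qed

lemma Delta2_commute: "Delta2 j k a y = Delta2 k j a y"
  by (simp add: Delta2_def Delta_def add.commute add.left_commute)

lemma Delta_shift: "Delta j (\<lambda>y. h (w + y)) = (\<lambda>y. Delta j h (w + y))"
  by (simp add: Delta_def fun_eq_iff add.assoc)

lemma Delta2_shift: "Delta2 j k (\<lambda>y. h (w + y)) = (\<lambda>y. Delta2 j k h (w + y))"
  by (simp add: Delta2_def Delta_shift)

text \<open>Telescoping along the path, at the cost of one second difference per step: taken at the
  start of a positive step and at the end of a negative one. Both points lie within the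
  radius.\<close>

lemma Delta_increment_bound:
  fixes a :: "int^'d \<Rightarrow> real"
  assumes M: "\<And>j k y. norm (rvec y) \<le> r \<Longrightarrow> \<bar>Delta2 j k a y\<bar> \<le> M"
  shows "norm (rvec y) \<le> r \<Longrightarrow> \<bar>Delta j a y - Delta j a 0\<bar> \<le> M * l1 y"
proof (induction y rule: lattice_induct)
  case (add y k)
  have n: "norm (rvec y) \<le> r" using norm_rvec_add[OF add(2)] add(3) by linarith
  have "Delta j a (y + ee k) = Delta j a y + Delta2 k j a y" by (simp add: Delta2_def Delta_def)
  then show ?case using add(1)[OF n] M[OF n, of k j] by (simp add: l1_add[OF add(2)] algebra_simps)
next
  case (diff y k)
  have n: "norm (rvec y) \<le> r" using norm_rvec_diff[OF diff(2)] diff(3) by linarith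
  have "Delta j a (y - ee k) = Delta j a y - Delta2 k j a (y - ee k)" by (simp add: Delta2_def Delta_def)
  then show ?case using diff(1)[OF n] M[OF diff(3), of k j] by (simp add: l1_diff[OF diff(2)] algebra_simps)
qed simp

text \<open>The bounds of \<open>Delta_increment_bound\<close> are summed along the path. A single
  negative step can already cost \<open>M\<close>, so the square carries no factor one half.\<close>

lemma lattice_Taylor1_bound:
  fixes a :: "int^'d \<Rightarrow> real"
  assumes M: "\<And>j k y. norm (rvec y) \<le> r \<Longrightarrow> \<bar>Delta2 j k a y\<bar> \<le> M" and M0: "0 \<le> M"
  shows "norm (rvec J) \<le> r \<Longrightarrow>
    \<bar>a J - a 0 - (\<Sum>j\<in>UNIV. real_of_int (J $ j) * Delta j a 0)\<bar> \<le> M * (l1 J)\<^sup>2"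
proof (induction J rule: lattice_induct)
  case (add y k)
  have n: "norm (rvec y) \<le> r" using norm_rvec_add[OF add(2)] add(3) by linarith
  have "a (y + ee k) = a y + Delta k a y" by (simp add: Delta_def)
  moreover have "M * l1 y + M * (l1 y)\<^sup>2 \<le> M * (l1 (y + ee k))\<^sup>2"
    using M0 l1_nonneg[of y] by (simp add: l1_add[OF add(2)] power2_eq_square algebra_simps)
  ultimately show ?case using add(1)[OF n] Delta_increment_bound[OF M n, of k]
    unfolding sum_add_ee by linarith
next
  case (diff y k)
  have n: "norm (rvec y) \<le> r" using norm_rvec_diff[OF diff(2)] diff(3) by linarith
  have "a (y - ee k) = a y - Delta k a (y - ee k)" by (simp add: Delta_def)
  moreover have "M * l1 (y - ee k) + M * (l1 y)\<^sup>2 \<le> M * (l1 (y - ee k))\<^sup>2"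
    using M0 l1_nonneg[of y] by (simp add: l1_diff[OF diff(2)] power2_eq_square algebra_simps)
  ultimately show ?case using diff(1)[OF n] Delta_increment_bound[OF M diff(3), of k]
      sum_add_ee[of "y - ee k" k "\<lambda>j. Delta j a 0"]
    unfolding diff_add_cancel by linarith
qed simp

text \<open>The term \<open>- coord_sum y\<close> comes from the steps in negative directions, which evaluate
  the difference at the far end of the step. It vanishes after summation against jump rates with
  zero drift; a bound by a multiple of \<open>(l1 y)\<^sup>2\<close> alone would lose a constant factor for unit
  jumps.\<close>

lemma Delta_Taylor1_bound:
  fixes a :: "int^'d \<Rightarrow> real"
  assumes S: "\<And>j k y. norm (rvec y) \<le> r \<Longrightarrow>
      \<bar>Delta2 j k a y - Delta2 j k a 0\<bar> \<le> 2 * \<kappa> * l1 y + q"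
  shows "norm (rvec y) \<le> r \<Longrightarrow>
    \<bar>Delta j a y - Delta j a 0 - (\<Sum>k\<in>UNIV. real_of_int (y $ k) * Delta2 j k a 0)\<bar>
      \<le> \<kappa> * ((l1 y)\<^sup>2 - coord_sum y) + q * l1 y"
proof (induction y rule: lattice_induct)
  case (add y k)
  have n: "norm (rvec y) \<le> r" using norm_rvec_add[OF add(2)] add(3) by linarith
  have "Delta j a (y + ee k) = Delta j a y + Delta2 j k a y"
    unfolding Delta2_commute[of j k] by (simp add: Delta2_def Delta_def)
  moreover have "\<kappa> * ((l1 (y + ee k))\<^sup>2 - coord_sum (y + ee k)) + q * l1 (y + ee k)
     = (\<kappa> * ((l1 y)\<^sup>2 - coord_sum y) + q * l1 y) + (2 * \<kappa> * l1 y + q)"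
    by (simp add: l1_add[OF add(2)] coord_sum_add power2_eq_square algebra_simps)
  ultimately show ?case using add(1)[OF n] S[OF n, of j k]
    unfolding sum_add_ee by linarith
next
  case (diff y k)
  have n: "norm (rvec y) \<le> r" using norm_rvec_diff[OF diff(2)] diff(3) by linarith
  have "Delta j a (y - ee k) = Delta j a y - Delta2 j k a (y - ee k)"
    unfolding Delta2_commute[of j k] by (simp add: Delta2_def Delta_def)
  moreover have "\<kappa> * ((l1 (y - ee k))\<^sup>2 - coord_sum (y - ee k)) + q * l1 (y - ee k)
     = (\<kappa> * ((l1 y)\<^sup>2 - coord_sum y) + q * l1 y) + (2 * \<kappa> * l1 (y - ee k) + q)"
    by (simp add: l1_diff[OF diff(2)] coord_sum_diff power2_eq_square algebra_simps)
  moreover have "(\<Sum>i\<in>UNIV. real_of_int (y $ i) * Delta2 j i a 0)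
      = (\<Sum>i\<in>UNIV. real_of_int ((y - ee k) $ i) * Delta2 j i a 0) + Delta2 j k a 0"
    using sum_add_ee[of "y - ee k" k "\<lambda>i. Delta2 j i a 0"] by simp
  ultimately show ?case using diff(1)[OF n] S[OF diff(3), of j k] by linarith
qed simp

text \<open>For symmetric \<open>D\<close> this is the second-order part of Newton's forward
  difference formula: the coefficient of \<open>D j j\<close> is the binomial
  \<open>J $ j * (J $ j - 1) / 2\<close>, also for negative \<open>J $ j\<close>.\<close>

definition quad_part :: "('d \<Rightarrow> 'd \<Rightarrow> real) \<Rightarrow> int^'d \<Rightarrow> real" where
  "quad_part D J = ((\<Sum>j\<in>UNIV. real_of_int (J $ j) * (\<Sum>k\<in>UNIV. real_of_int (J $ k) * D j k))
     - (\<Sum>j\<in>UNIV. real_of_int (J $ j) * D j j)) / 2"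

text \<open>The two cross terms agree by symmetry, and the diagonal correction cancels the extra
  \<open>D m m\<close>. The increment is thus exactly the linear polynomial subtracted in
  \<open>Delta_Taylor1_bound\<close>.\<close>

lemma quad_part_add:
  fixes D :: "'d::finite \<Rightarrow> 'd \<Rightarrow> real"
  assumes "\<And>j k. D j k = D k j"
  shows "quad_part D (J + ee m) = quad_part D J + (\<Sum>k\<in>UNIV. real_of_int (J $ k) * D m k)"
proof -
  have "(\<Sum>j\<in>UNIV. real_of_int (J $ j) * D j m) = (\<Sum>k\<in>UNIV. real_of_int (J $ k) * D m k)"
    by (subst assms) simp
  then show ?thesis
    unfolding quad_part_def sum_add_ee by (simp add: distrib_left sum.distrib add_divide_distrib)
qed

text \<open>The first-order expansions of the differences \<open>Delta k a\<close> from
  \<open>Delta_Taylor1_bound\<close> are summed along the path to \<open>J\<close>.\<close>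

lemma lattice_Taylor2_bound:
  fixes a :: "int^'d \<Rightarrow> real"
  assumes S: "\<And>j k y. norm (rvec y) \<le> r \<Longrightarrow>
      \<bar>Delta2 j k a y - Delta2 j k a 0\<bar> \<le> 2 * \<kappa> * l1 y + q"
    and q0: "0 \<le> q" and \<kappa>0: "0 \<le> \<kappa>"
  shows "norm (rvec J) \<le> r \<Longrightarrow>
    \<bar>a J - a 0 - (\<Sum>j\<in>UNIV. real_of_int (J $ j) * Delta j a 0) - quad_part (\<lambda>j k. Delta2 j k a 0) J\<bar>
      \<le> \<kappa> * (l1 J ^ 3 - coord_sum J) + q * (l1 J)\<^sup>2"
proof (induction J rule: lattice_induct)
  case zero
  then show ?case by (simp add: quad_part_def)
next
  case (add y k)
  have n: "norm (rvec y) \<le> r" using norm_rvec_add[OF add(2)] add(3) by linarith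
  have "a (y + ee k) = a y + Delta k a y" by (simp add: Delta_def)
  \<comment> \<open>The growth of the cube and of the square pays for the error of the new step;
    what is left over is nonnegative because \<open>coord_sum y\<close> is at least
    \<open>- l1 y\<close>.\<close>
  moreover have "\<kappa> * (l1 (y + ee k) ^ 3 - coord_sum (y + ee k)) + q * (l1 (y + ee k))\<^sup>2
     \<ge> (\<kappa> * (l1 y ^ 3 - coord_sum y) + q * (l1 y)\<^sup>2) + (\<kappa> * ((l1 y)\<^sup>2 - coord_sum y) + q * l1 y)"
  proof -
    have neg: "0 \<le> l1 y + coord_sum y" using coord_sum_ge[of y] by linarith
    have "0 \<le> \<kappa> * (2 * (l1 y)\<^sup>2 + 2 * l1 y + (l1 y + coord_sum y)) + q * (l1 y + 1)"
      using zero_le_power2[of "l1 y"] l1_nonneg[of y] neg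
      by (intro add_nonneg_nonneg[OF mult_nonneg_nonneg[OF \<kappa>0] mult_nonneg_nonneg[OF q0]]) linarith+
    then show ?thesis
      by (simp add: l1_add[OF add(2)] coord_sum_add power2_eq_square power3_eq_cube algebra_simps)
  qed
  ultimately show ?case
    using add(1)[OF n] Delta_Taylor1_bound[OF S n, of k]
    unfolding quad_part_add[OF Delta2_commute] sum_add_ee by linarith
next
  case (diff y k)
  have n: "norm (rvec y) \<le> r" using norm_rvec_diff[OF diff(2)] diff(3) by linarith
  let ?z = "y - ee k"
  have "a ?z = a y - Delta k a ?z" by (simp add: Delta_def)
  moreover have "\<kappa> * (l1 ?z ^ 3 - coord_sum ?z) + q * (l1 ?z)\<^sup>2
     \<ge> (\<kappa> * (l1 y ^ 3 - coord_sum y) + q * (l1 y)\<^sup>2) + (\<kappa> * ((l1 ?z)\<^sup>2 - coord_sum ?z) + q * l1 ?z)"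
  proof -
    have neg: "0 \<le> l1 y + coord_sum y" using coord_sum_ge[of y] by linarith
    have "0 \<le> \<kappa> * (2 * (l1 y)\<^sup>2 + (l1 y + coord_sum y)) + q * l1 y"
      using zero_le_power2[of "l1 y"] l1_nonneg[of y] neg
      by (intro add_nonneg_nonneg[OF mult_nonneg_nonneg[OF \<kappa>0] mult_nonneg_nonneg[OF q0]]) linarith+
    then show ?thesis
      by (simp add: l1_diff[OF diff(2)] coord_sum_diff power2_eq_square power3_eq_cube algebra_simps)
  qed
  moreover have "(\<Sum>j\<in>UNIV. real_of_int (y $ j) * Delta j a 0)
      = (\<Sum>j\<in>UNIV. real_of_int (?z $ j) * Delta j a 0) + Delta k a 0"
    using sum_add_ee[of ?z k "\<lambda>i. Delta i a 0"] by simp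
  moreover have "quad_part (\<lambda>j k. Delta2 j k a 0) y = quad_part (\<lambda>j k. Delta2 j k a 0) ?z
      + (\<Sum>i\<in>UNIV. real_of_int (?z $ i) * Delta2 k i a 0)"
    using quad_part_add[of "\<lambda>j k. Delta2 j k a 0" ?z k, OF Delta2_commute] by simp
  ultimately show ?case
    using diff(1)[OF n] Delta_Taylor1_bound[OF S diff(3), of k] by linarith
qed

subsection \<open>Total variation distance under shifts\<close>

lemma dTV_ge: "\<bar>measure_pmf.prob p A - measure_pmf.prob q A\<bar> \<le> dTV p q"
  unfolding dTV_def
proof (rule cSUP_upper)
  have "\<bar>measure_pmf.prob p A - measure_pmf.prob q A\<bar> \<le> 1" for A
    using measure_pmf.prob_le_1[of p A] measure_pmf.prob_le_1[of q A]
      measure_nonneg[of p A] measure_nonneg[of q A] by linarith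
  then show "bdd_above (range (\<lambda>A. \<bar>measure_pmf.prob p A - measure_pmf.prob q A\<bar>))"
    by (intro bdd_aboveI2)
qed simp

text \<open>Split the support by the sign of \<open>pmf p x - pmf q x\<close>. Each half is an event
  and costs one \<open>dTV\<close>, which is a supremum over events; hence the factor 2.\<close>

lemma dTV_expectation_diff:
  fixes f :: "'a \<Rightarrow> real"
  assumes fin: "finite {x. f x \<noteq> 0}" and M: "\<And>x. \<bar>f x\<bar> \<le> M"
  shows "\<bar>measure_pmf.expectation p f - measure_pmf.expectation q f\<bar> \<le> 2 * M * dTV p q"
proof -
  define S where "S = {x. f x \<noteq> 0}"
  define P where "P = {x\<in>S. pmf q x \<le> pmf p x}"
  define N where "N = {x\<in>S. pmf p x < pmf q x}"
  have fin: "finite S" "finite P" "finite N" using fin by (auto simp: S_def P_def N_def)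
  have split: "S = P \<union> N" "P \<inter> N = {}" by (auto simp: P_def N_def)
  have M0: "0 \<le> M" using M[of undefined] by linarith
  have "measure_pmf.expectation p f - measure_pmf.expectation q f = (\<Sum>x\<in>S. f x * (pmf p x - pmf q x))"
    by (simp add: integral_measure_pmf_real[OF fin(1)] S_def right_diff_distrib sum_subtractf)
  also have "\<bar>\<dots>\<bar> \<le> (\<Sum>x\<in>S. M * \<bar>pmf p x - pmf q x\<bar>)"
    by (rule order_trans[OF sum_abs sum_mono]) (simp add: abs_mult mult_right_mono M)
  also have "\<dots> = M * ((\<Sum>x\<in>P. \<bar>pmf p x - pmf q x\<bar>) + (\<Sum>x\<in>N. \<bar>pmf p x - pmf q x\<bar>))"
    unfolding split(1) using fin split(2) by (simp add: sum.union_disjoint sum_distrib_left distrib_left)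
  also have "(\<Sum>x\<in>P. \<bar>pmf p x - pmf q x\<bar>) = measure_pmf.prob p P - measure_pmf.prob q P"
    using fin by (simp add: measure_measure_pmf_finite P_def sum_subtractf)
  also have "(\<Sum>x\<in>N. \<bar>pmf p x - pmf q x\<bar>) = - (measure_pmf.prob p N - measure_pmf.prob q N)"
    using fin by (simp add: measure_measure_pmf_finite N_def sum_subtractf)
  also have "M * (measure_pmf.prob p P - measure_pmf.prob q P + - (measure_pmf.prob p N - measure_pmf.prob q N))
      \<le> M * (dTV p q + dTV p q)"
    using dTV_ge[of p P q] dTV_ge[of p N q] M0 by (intro mult_left_mono) linarith+
  finally show ?thesis by (simp add: algebra_simps)
qed

lemma finite_support_shift:
  fixes f :: "int^'d \<Rightarrow> real"
  assumes "finite {x. f x \<noteq> 0}"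
  shows "finite {x. f (x + y) \<noteq> 0}"
proof -
  have "{x. f (x + y) \<noteq> 0} \<subseteq> (\<lambda>x. x - y) ` {x. f x \<noteq> 0}"
    by (force simp: image_iff intro: exI[where x = "_ + y"])
  then show ?thesis using assms finite_surj by blast
qed

text \<open>Along a path from \<open>0\<close> to \<open>y\<close> each unit step compares
  \<open>p\<close> with its unit shift, for a translate of \<open>f\<close> with the same bound. A
  negative step is the same comparison read from its other end.\<close>

lemma dTV_shift_expectation:
  fixes f :: "int^'d \<Rightarrow> real"
  assumes fin: "finite {x. f x \<noteq> 0}" and M: "\<And>x. \<bar>f x\<bar> \<le> M"
    and tv: "\<And>j. dTV p (map_pmf (\<lambda>w. w + ee j) p) \<le> \<epsilon>"
  shows "\<bar>measure_pmf.expectation p (\<lambda>w. f (w + y)) - measure_pmf.expectation p f\<bar> \<le> 2 * M * \<epsilon> * l1 y"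
proof -
  have M0: "0 \<le> M" using M[of 0] by linarith
  have step: "\<bar>measure_pmf.expectation p (\<lambda>w. f (w + y)) - measure_pmf.expectation p (\<lambda>w. f (w + (y + ee j)))\<bar>
      \<le> 2 * M * \<epsilon>" for y j
  proof -
    have "measure_pmf.expectation (map_pmf (\<lambda>w. w + ee j) p) (\<lambda>w. f (w + y))
        = measure_pmf.expectation p (\<lambda>w. f (w + (y + ee j)))"
      by (simp add: integral_map_pmf algebra_simps)
    then have "\<bar>measure_pmf.expectation p (\<lambda>w. f (w + y)) - measure_pmf.expectation p (\<lambda>w. f (w + (y + ee j)))\<bar>
        \<le> 2 * M * dTV p (map_pmf (\<lambda>w. w + ee j) p)"
      using dTV_expectation_diff[OF finite_support_shift[OF fin, of y] M, of p "map_pmf (\<lambda>w. w + ee j) p"] by simp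
    also have "\<dots> \<le> 2 * M * \<epsilon>" using tv M0 by (intro mult_left_mono) auto
    finally show ?thesis .
  qed
  show ?thesis
  proof (induction y rule: lattice_induct)
    case (add y j)
    then show ?case using step[of y j] by (simp add: l1_add algebra_simps)
  next
    case (diff y j)
    then show ?case using step[of "y - ee j" j] by (simp add: l1_diff algebra_simps)
  qed simp
qed

text \<open>A sum over \<open>B\<close> is not a full expectation, so shifts cannot be applied to it
  directly. Cutting \<open>f\<close> off outside \<open>C\<close> gives a bounded function of finite
  support, whose full expectations are compared; its increments at points outside \<open>B\<close>,
  at most \<open>2 * M\<close> each, produce the probability term.\<close>

lemma shift_restricted_sum_bound:
  fixes f :: "int^'d \<Rightarrow> real"
  assumes finB: "finite B" and finC: "finite C" and BC: "B \<subseteq> C" and By: "\<And>w. w \<in> B \<Longrightarrow> w + y \<in> C"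
    and M: "\<And>x. x \<in> C \<Longrightarrow> \<bar>f x\<bar> \<le> M" and M0: "0 \<le> M"
    and tv: "\<And>j. dTV p (map_pmf (\<lambda>w. w + ee j) p) \<le> \<epsilon>"
  shows "\<bar>(\<Sum>w\<in>B. pmf p w * f (w + y)) - (\<Sum>w\<in>B. pmf p w * f w)\<bar>
    \<le> 2 * M * \<epsilon> * l1 y + 2 * M * measure_pmf.prob p (- B)"
proof -
  define F where "F x = f x * indicator C x" for x
  have FM: "\<bar>F x\<bar> \<le> M" for x using M M0 by (simp add: F_def indicator_def)
  have supp: "finite {x. F x \<noteq> 0}"
    by (rule finite_subset[OF _ finC]) (auto simp: F_def indicator_def split: if_splits)
  define G where "G w = F (w + y) - F w" for w
  have GM: "\<bar>G w\<bar> \<le> 2 * M" for w using FM[of "w + y"] FM[of w] by (simp add: G_def)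
  have int: "integrable (measure_pmf p) g" if "\<And>w. \<bar>g w\<bar> \<le> K" for g :: "int^'d \<Rightarrow> real" and K
    using that by (intro measure_pmf.integrable_const_bound[where B = K]) auto
  have "(\<Sum>w\<in>B. pmf p w * f (w + y)) - (\<Sum>w\<in>B. pmf p w * f w) = (\<Sum>w\<in>B. G w * indicator B w * pmf p w)"
    unfolding sum_subtractf[symmetric]
    by (rule sum.cong) (use By BC in \<open>auto simp: G_def F_def algebra_simps\<close>)
  also have "\<dots> = measure_pmf.expectation p (\<lambda>w. G w * indicator B w)"
    by (rule integral_measure_pmf_real[symmetric, OF finB]) (auto simp: indicator_def split: if_splits)
  also have "\<dots> = measure_pmf.expectation p (\<lambda>w. G w - G w * indicator (- B) w)"
    by (rule Bochner_Integration.integral_cong) (auto simp: indicator_def)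
  also have "\<dots> = measure_pmf.expectation p G - measure_pmf.expectation p (\<lambda>w. G w * indicator (- B) w)"
    by (intro Bochner_Integration.integral_diff int[where K = "2 * M"])
      (use GM M0 in \<open>auto simp: indicator_def\<close>)
  also have "measure_pmf.expectation p G
      = measure_pmf.expectation p (\<lambda>w. F (w + y)) - measure_pmf.expectation p F"
    unfolding G_def by (intro Bochner_Integration.integral_diff int[where K = M]) (use FM in auto)
  finally have eq: "(\<Sum>w\<in>B. pmf p w * f (w + y)) - (\<Sum>w\<in>B. pmf p w * f w)
     = measure_pmf.expectation p (\<lambda>w. F (w + y)) - measure_pmf.expectation p F
       - measure_pmf.expectation p (\<lambda>w. G w * indicator (- B) w)" .
  have "\<bar>measure_pmf.expectation p (\<lambda>w. G w * indicator (- B) w)\<bar>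
      \<le> measure_pmf.expectation p (\<lambda>w. \<bar>G w * indicator (- B) w\<bar>)"
    by (rule integral_abs_bound)
  also have "\<dots> \<le> measure_pmf.expectation p (\<lambda>w. 2 * M * indicator (- B) w)"
    by (intro integral_mono int[where K = "2 * M"]) (use GM M0 in \<open>auto simp: indicator_def\<close>)
  also have "\<dots> = 2 * M * measure_pmf.prob p (- B)" by simp
  finally show ?thesis
    using eq dTV_shift_expectation[OF supp FM tv, of y] by linarith
qed

subsection \<open>Local norms, Taylor bounds and the size of jumps\<close>

lemma finite_lattice_norm_le:
  fixes b :: "real^'d"
  shows "finite {X :: int^'d. norm (rvec X - b) \<le> K}"
proof -
  define m where "m = \<lceil>K + norm b\<rceil>"
  have "{X :: int^'d. norm (rvec X - b) \<le> K} \<subseteq> vec_lambda ` (UNIV \<rightarrow>\<^sub>E {- m..m})"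
  proof
    fix X :: "int^'d" assume "X \<in> {X. norm (rvec X - b) \<le> K}"
    then have K: "norm (rvec X) \<le> K + norm b"
      using norm_triangle_ineq2[of "rvec X" b] by simp
    have "X $ i \<in> {- m..m}" for i
    proof -
      have "\<bar>real_of_int (X $ i)\<bar> \<le> norm (rvec X)"
        using component_le_norm_cart[of "rvec X" i] by (simp add: rvec_def)
      then have "real_of_int \<bar>X $ i\<bar> \<le> K + norm b" using K by simp
      then have "\<bar>X $ i\<bar> \<le> m" unfolding m_def by linarith
      then show ?thesis by auto
    qed
    then have "vec_nth X \<in> UNIV \<rightarrow>\<^sub>E {- m..m}" by auto
    then show "X \<in> vec_lambda ` (UNIV \<rightarrow>\<^sub>E {- m..m})"
      by (metis image_eqI vec_nth_inverse)
  qed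
  then show ?thesis
    by (rule finite_subset) (intro finite_imageI finite_PiE, auto)
qed

text \<open>Finiteness gives meaning to the \<open>Max\<close> in \<open>normD1\<close> and
  \<open>normD2\<close> and turns restricted expectations into finite sums.\<close>

lemma finite_lattice_normS_le:
  fixes Sig :: "real^'d^'d" and b :: "real^'d"
  assumes "symmetric_mat Sig" "pos_def Sig"
  shows "finite {X :: int^'d. normS Sig (rvec X - b) \<le> a}"
proof (rule finite_subset)
  show "{X :: int^'d. normS Sig (rvec X - b) \<le> a} \<subseteq> {X. norm (rvec X - b) \<le> sqrt (lam_max Sig * a\<^sup>2)}"
  proof safe
    fix X :: "int^'d" assume "normS Sig (rvec X - b) \<le> a"
    then have "(normS Sig (rvec X - b))\<^sup>2 \<le> a\<^sup>2"
      using normS_nonneg[OF assms] by (intro power_mono) auto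
    then have "lam_max Sig * (normS Sig (rvec X - b))\<^sup>2 \<le> lam_max Sig * a\<^sup>2"
      using lam_pos[OF assms] by (intro mult_left_mono) auto
    then show "norm (rvec X - b) \<le> sqrt (lam_max Sig * a\<^sup>2)"
      using norm_le_normS[OF assms, of "rvec X - b"] by (intro real_le_rsqrt) linarith
  qed
qed (rule finite_lattice_norm_le)

lemma Delta_le_normD1:
  fixes Sig :: "real^'d^'d"
  assumes "symmetric_mat Sig" "pos_def Sig" and X: "normS Sig (rvec X - real n *\<^sub>R c) \<le> a"
  shows "\<bar>Delta j h X\<bar> \<le> normD1 Sig n c h a"
proof -
  have "{\<bar>Delta j h X\<bar> | X j. normS Sig (rvec X - real n *\<^sub>R c) \<le> a}
      = (\<lambda>(X, j). \<bar>Delta j h X\<bar>) ` ({X. normS Sig (rvec X - real n *\<^sub>R c) \<le> a} \<times> UNIV)"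
    by (auto simp: image_iff)
  then have "finite {\<bar>Delta j h X\<bar> | X j. normS Sig (rvec X - real n *\<^sub>R c) \<le> a}"
    using finite_lattice_normS_le[OF assms(1,2)] by simp
  then show ?thesis unfolding normD1_def using X by (intro Max_ge) auto
qed

lemma Delta2_le_normD2:
  fixes Sig :: "real^'d^'d"
  assumes "symmetric_mat Sig" "pos_def Sig" and X: "normS Sig (rvec X - real n *\<^sub>R c) \<le> a"
  shows "\<bar>Delta2 j k h X\<bar> \<le> normD2 Sig n c h a"
proof -
  have "{\<bar>Delta2 j k h X\<bar> | X j k. normS Sig (rvec X - real n *\<^sub>R c) \<le> a}
      = (\<lambda>(X, j, k). \<bar>Delta2 j k h X\<bar>) ` ({X. normS Sig (rvec X - real n *\<^sub>R c) \<le> a} \<times> UNIV \<times> UNIV)"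
    by (auto simp: image_iff) metis
  then have "finite {\<bar>Delta2 j k h X\<bar> | X j k. normS Sig (rvec X - real n *\<^sub>R c) \<le> a}"
    using finite_lattice_normS_le[OF assms(1,2)] by simp
  then show ?thesis unfolding normD2_def using X by (intro Max_ge) auto
qed

lemma normD1_nonneg:
  fixes Sig :: "real^'d^'d"
  assumes "symmetric_mat Sig" "pos_def Sig"
  shows "0 \<le> normD1 Sig n c h a"
proof (cases "\<exists>X. normS Sig (rvec X - real n *\<^sub>R c) \<le> a")
  case True
  then obtain X where "normS Sig (rvec X - real n *\<^sub>R c) \<le> a" by blast
  from Delta_le_normD1[OF assms this, of undefined h] show ?thesis by linarith
qed (simp add: normD1_def)

lemma normD2_nonneg:
  fixes Sig :: "real^'d^'d"
  assumes "symmetric_mat Sig" "pos_def Sig"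
  shows "0 \<le> normD2 Sig n c h a"
proof (cases "\<exists>X. normS Sig (rvec X - real n *\<^sub>R c) \<le> a")
  case True
  then obtain X where "normS Sig (rvec X - real n *\<^sub>R c) \<le> a" by blast
  from Delta2_le_normD2[OF assms this, of undefined undefined h] show ?thesis by linarith
qed (simp add: normD2_def)

lemma gradient_increment_bound:
  fixes f :: "real^'d \<Rightarrow> real" and Df :: "real^'d \<Rightarrow> real^'d"
  assumes D: "\<And>x. x \<in> cball c r \<Longrightarrow> (f has_derivative (\<lambda>y. Df x \<bullet> y)) (at x within cball c r)"
    and K: "\<And>x. x \<in> cball c r \<Longrightarrow> norm (Df x) \<le> K"
    and x: "x \<in> cball c r"
  shows "\<bar>f x - f c\<bar> \<le> K * norm (x - c)"
proof -
  have "c \<in> cball c r" using x by (auto intro: order_trans[OF zero_le_dist])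
  moreover have "onorm (\<lambda>y. Df x \<bullet> y) \<le> K" if "x \<in> cball c r" for x
  proof (rule onorm_le)
    fix y
    have "norm (Df x \<bullet> y) \<le> norm (Df x) * norm y"
      using Cauchy_Schwarz_ineq2 by simp
    also have "\<dots> \<le> K * norm y" using K[OF that] by (simp add: mult_right_mono)
    finally show "norm (Df x \<bullet> y) \<le> K * norm y" .
  qed
  ultimately have "norm (f x - f c) \<le> K * norm (x - c)"
    by (intro differentiable_bound[OF convex_cball D _ x])
  then show ?thesis by simp
qed

text \<open>Second-order Taylor formula for \<open>f\<close> along the segment from \<open>c\<close>
  to \<open>c + \<xi>\<close>. The strict inequality keeps the segment in the open ball, where
  derivatives within the closed ball are ordinary derivatives.\<close>

lemma gradient_Taylor_bound:
  fixes f :: "real^'d \<Rightarrow> real" and Df :: "real^'d \<Rightarrow> real^'d" and D2f :: "real^'d \<Rightarrow> real^'d^'d"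
  assumes D1: "\<And>x. x \<in> cball c r \<Longrightarrow> (f has_derivative (\<lambda>y. Df x \<bullet> y)) (at x within cball c r)"
    and D2: "\<And>x. x \<in> cball c r \<Longrightarrow> (Df has_derivative (\<lambda>y. D2f x *v y)) (at x within cball c r)"
    and K: "\<And>x. x \<in> cball c r \<Longrightarrow> onorm (\<lambda>y. D2f x *v y) \<le> K"
    and x: "norm \<xi> < r"
  shows "\<bar>f (c + \<xi>) - f c - Df c \<bullet> \<xi>\<bar> \<le> K / 2 * (norm \<xi>)\<^sup>2"
proof -
  have inb: "c + t *\<^sub>R \<xi> \<in> ball c r" if "0 \<le> t" "t \<le> 1" for t
  proof -
    have "norm (t *\<^sub>R \<xi>) \<le> norm \<xi>" using that by (simp add: mult_left_le_one_le)
    then show ?thesis using x by (simp add: dist_norm)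
  qed
  have at: "at y within cball c r = at y" if "y \<in> ball c r" for y
    using that by (intro at_within_interior) (simp add: interior_cball)
  \<comment> \<open>The sequence of derivatives along the segment that \<open>Maclaurin2\<close>
    expects; the expansion stops at index 2.\<close>
  define \<phi> where "\<phi> m t = (if m = 0 then f (c + t *\<^sub>R \<xi>)
      else if m = 1 then Df (c + t *\<^sub>R \<xi>) \<bullet> \<xi>
      else (D2f (c + t *\<^sub>R \<xi>) *v \<xi>) \<bullet> \<xi>)" for m :: nat and t :: real
  have \<phi>: "\<phi> 0 = (\<lambda>t. f (c + t *\<^sub>R \<xi>))" "\<phi> 1 = (\<lambda>t. Df (c + t *\<^sub>R \<xi>) \<bullet> \<xi>)"
    "\<phi> 2 = (\<lambda>t. (D2f (c + t *\<^sub>R \<xi>) *v \<xi>) \<bullet> \<xi>)"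
    by (simp_all add: \<phi>_def fun_eq_iff)
  have line: "((\<lambda>t. c + t *\<^sub>R \<xi>) has_derivative (\<lambda>s. s *\<^sub>R \<xi>)) (at t)" for t
    by (auto intro!: derivative_eq_intros)
  have d0: "DERIV (\<phi> 0) t :> \<phi> 1 t" if "0 \<le> t" "t \<le> 1" for t
  proof -
    have "(f has_derivative (\<lambda>y. Df (c + t *\<^sub>R \<xi>) \<bullet> y)) (at (c + t *\<^sub>R \<xi>))"
      using D1[of "c + t *\<^sub>R \<xi>"] inb[OF that] at by auto
    from has_derivative_compose[OF line this]
    show ?thesis unfolding \<phi> has_field_derivative_def by (simp add: mult.commute[of _ "_ \<bullet> _"])
  qed
  have d1: "DERIV (\<phi> 1) t :> \<phi> 2 t" if "0 \<le> t" "t \<le> 1" for t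
  proof -
    have "(Df has_derivative (\<lambda>y. D2f (c + t *\<^sub>R \<xi>) *v y)) (at (c + t *\<^sub>R \<xi>))"
      using D2[of "c + t *\<^sub>R \<xi>"] inb[OF that] at by auto
    from has_derivative_inner_left[OF has_derivative_compose[OF line this], of \<xi>]
    show ?thesis
      unfolding \<phi> has_field_derivative_def
      by (simp add: matrix_vector_mult_scaleR mult.commute[of _ "_ \<bullet> _"])
  qed
  have "\<exists>t. 0 < t \<and> t \<le> 1 \<and> \<phi> 0 1 = (\<Sum>m<2. \<phi> m 0 / fact m * 1 ^ m) + \<phi> 2 t / fact 2 * 1 ^ 2"
  proof (rule Maclaurin2)
    show "\<forall>m t. m < 2 \<and> 0 \<le> t \<and> t \<le> 1 \<longrightarrow> DERIV (\<phi> m) t :> \<phi> (Suc m) t"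
    proof (intro allI impI)
      fix m :: nat and t :: real
      assume *: "m < 2 \<and> 0 \<le> t \<and> t \<le> 1"
      then consider "m = 0" | "m = 1" by linarith
      then show "DERIV (\<phi> m) t :> \<phi> (Suc m) t"
        using d0[of t] d1[of t] * by cases (auto simp: numeral_2_eq_2)
    qed
  qed auto
  then obtain t where t: "0 < t" "t \<le> 1" "\<phi> 0 1 = \<phi> 0 0 + \<phi> 1 0 + \<phi> 2 t / 2"
    by (auto simp: numeral_2_eq_2)
  then have "\<bar>f (c + \<xi>) - f c - Df c \<bullet> \<xi>\<bar> = \<bar>\<phi> 2 t\<bar> / 2" by (simp add: \<phi>_def)
  moreover have "\<bar>\<phi> 2 t\<bar> \<le> K * (norm \<xi>)\<^sup>2"
  proof -
    let ?y = "c + t *\<^sub>R \<xi>"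
    have y: "?y \<in> cball c r" using inb[of t] t by simp
    have "\<bar>\<phi> 2 t\<bar> \<le> norm (D2f ?y *v \<xi>) * norm \<xi>"
      unfolding \<phi>_def using Cauchy_Schwarz_ineq2 by simp
    also have "norm (D2f ?y *v \<xi>) \<le> onorm (\<lambda>y. D2f ?y *v y) * norm \<xi>"
      by (rule onorm) (simp add: linear_linear)
    also have "\<dots> \<le> K * norm \<xi>" using K[OF y] by (simp add: mult_right_mono)
    finally show ?thesis by (simp add: power2_eq_square mult.assoc mult_right_mono)
  qed
  ultimately show ?thesis by simp
qed

lemma onorm_matrix_le:
  fixes M :: "real^'d^'d"
  shows "onorm (\<lambda>y. M *v y) \<le> real CARD('d) * norm M"
proof (rule onorm_le)
  fix y
  have "norm (M *v y) \<le> (\<Sum>i\<in>UNIV. \<bar>(M *v y) $ i\<bar>)" by (rule norm_le_l1_cart)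
  also have "\<dots> \<le> (\<Sum>i\<in>(UNIV::'d set). norm M * norm y)"
  proof (rule sum_mono)
    fix i
    have "\<bar>(M *v y) $ i\<bar> \<le> norm (M $ i) * norm y"
      unfolding matrix_vector_mul_component by (rule Cauchy_Schwarz_ineq2)
    also have "\<dots> \<le> norm M * norm y"
      by (intro mult_right_mono Finite_Cartesian_Product.norm_nth_le) simp
    finally show "\<bar>(M *v y) $ i\<bar> \<le> norm M * norm y" .
  qed
  finally show "norm (M *v y) \<le> real CARD('d) * norm M * norm y" by simp
qed

text \<open>Undoes the normalisation in \<open>L0\<close>, \<open>L1\<close> and \<open>L2\<close>,
  giving pointwise bounds proportional to the rate at \<open>c\<close>. Boundedness is essential,
  since \<open>SUP\<close> has no useful meaning on an unbounded set of reals.\<close>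

lemma Max_SUP_div_bound:
  fixes F :: "'a \<Rightarrow> 'b \<Rightarrow> real"
  assumes "finite Js" "J \<in> Js" "0 < G J" "x \<in> S" "bdd_above (F J ` S)"
  shows "F J x \<le> Max ((\<lambda>J. (SUP x\<in>S. F J x) / G J) ` Js) * G J"
proof -
  have "F J x \<le> (SUP x\<in>S. F J x)" using assms by (intro cSUP_upper)
  also have "\<dots> = (SUP x\<in>S. F J x) / G J * G J" using assms by simp
  also have "\<dots> \<le> Max ((\<lambda>J. (SUP x\<in>S. F J x) / G J) ` Js) * G J"
    using assms by (intro mult_right_mono Max_ge) auto
  finally show ?thesis .
qed

lemma compact_norm_bdd_above:
  fixes f :: "'a::topological_space \<Rightarrow> 'b::real_normed_vector"
  assumes "compact S" "continuous_on S f"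
  shows "\<exists>K. \<forall>x\<in>S. norm (f x) \<le> K"
  using compact_imp_bounded[OF compact_continuous_image[OF assms(2,1)]] by (auto simp: bounded_iff)

text \<open>\<open>LEAST\<close> is informative only if some index qualifies; one does because
  \<open>psi\<close> tends to 0.\<close>

lemma psi_inv_props:
  fixes Js :: "(int^'d) set"
  assumes \<theta>: "0 < theta1 Js g c \<delta>0 Sig" and \<eta>: "0 < \<eta>"
  shows "4 \<le> psi_inv Js g c \<delta>0 Sig \<eta>"
    "psi Js g c \<delta>0 Sig (real (psi_inv Js g c \<delta>0 Sig \<eta>)) \<le> \<eta>"
proof -
  define D where "D = real CARD('d) * theta1 Js g c \<delta>0 Sig"
  have D: "D > 0" using \<theta> by (simp add: D_def)
  have "((\<lambda>m::nat. 4 * sqrt (ln (real m) / (D * real m powr (3/4)))) \<longlongrightarrow> 0) at_top"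
    using D by real_asymp
  then have "eventually (\<lambda>m::nat. 4 * sqrt (ln (real m) / (D * real m powr (3/4))) < \<eta>) at_top"
    using \<eta> by (rule order_tendstoD(2))
  then have "eventually (\<lambda>m. 4 \<le> m \<and> psi Js g c \<delta>0 Sig (real m) \<le> \<eta>) at_top"
    using eventually_ge_at_top[of 4] by eventually_elim (auto simp: psi_def D_def)
  then obtain m where "4 \<le> m \<and> psi Js g c \<delta>0 Sig (real m) \<le> \<eta>"
    by (auto simp: eventually_at_top_linorder)
  then have "4 \<le> psi_inv Js g c \<delta>0 Sig \<eta> \<and> psi Js g c \<delta>0 Sig (real (psi_inv Js g c \<delta>0 Sig \<eta>)) \<le> \<eta>"
    unfolding psi_inv_def by (rule LeastI)
  then show "4 \<le> psi_inv Js g c \<delta>0 Sig \<eta>"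
    "psi Js g c \<delta>0 Sig (real (psi_inv Js g c \<delta>0 Sig \<eta>)) \<le> \<eta>" by auto
qed

text \<open>All powers become integral in the eighth root \<open>x\<close> of \<open>n\<close>. The
  dimension is at most \<open>x\<^sup>2\<close>, so the jump condition gives
  \<open>5 * JS \<le> x ^ 5\<close>, while the condition on \<open>psi\<close> gives
  \<open>64 * sqrt \<rho> \<le> \<delta> * x ^ 3\<close>. Their combination is stronger than the
  claim.\<close>

lemma jump_radius_bound:
  fixes d n m JS D \<rho> \<delta> :: real
  assumes d: "1 \<le> d" "d ^ 4 \<le> n" and JS: "0 \<le> JS" and J: "(5 * (JS / d)) powr (8/3) \<le> n"
    and m: "4 \<le> m" "m \<le> n" and D: "0 < D" "D \<le> 1 / (64 * \<rho>)" and \<rho>: "1 \<le> \<rho>"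
    and psi: "4 * sqrt (ln m / (D * m powr (3/4))) \<le> \<delta> / 2"
  shows "sqrt \<rho> * JS \<le> n * \<delta> / 12"
proof -
  have n: "4 \<le> n" using m by simp
  define x where "x = n powr (1/8)"
  have x: "x > 0" using n by (simp add: x_def)
  have xpow: "x ^ k = n powr (real k / 8)" for k
    using n by (simp add: x_def powr_powr flip: powr_realpow)
  have x8: "x ^ 8 = n" using n by (simp add: xpow)
  have dx: "d \<le> x\<^sup>2"
  proof (rule power_le_imp_le_base)
    show "d ^ Suc 3 \<le> (x\<^sup>2) ^ Suc 3" using d(2) x8 by (simp flip: power_mult)
  qed simp
  have "5 * (JS / d) = ((5 * (JS / d)) powr (8/3)) powr (3/8)"
    using JS d by (simp add: powr_powr)
  also have "\<dots> \<le> n powr (3/8)" using J by (intro powr_mono2) auto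
  also have "\<dots> = x ^ 3" by (simp add: xpow)
  finally have "5 * JS \<le> x ^ 3 * d" using d by (simp add: field_simps)
  also have "\<dots> \<le> x ^ 3 * x\<^sup>2" using dx x by (intro mult_left_mono) auto
  finally have JS5: "5 * JS \<le> x ^ 5" by (simp flip: power_add)
  \<comment> \<open>The bound from \<open>psi\<close> is available at \<open>m\<close> only.
    Estimating \<open>ln m\<close> below by 1 and the power of \<open>m\<close> above by that of
    \<open>n\<close> transfers it to \<open>n\<close>.\<close>
  have "exp 1 \<le> m" using exp_le m by linarith
  then have lnm: "1 \<le> ln m" using m by (simp add: ln_ge_iff)
  have "m powr (3/4) \<le> n powr (3/4)" using m by (intro powr_mono2) auto
  also have "\<dots> = x ^ 6" by (simp add: xpow)
  finally have m6: "m powr (3/4) \<le> x ^ 6" .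
  have D64: "64 * \<rho> * D \<le> 1" using D \<rho> by (simp add: field_simps)
  have "64 * \<rho> / x ^ 6 \<le> ln m / (D * m powr (3/4))"
  proof -
    have "64 * \<rho> * (D * m powr (3/4)) \<le> 1 * x ^ 6"
      using D64 m6 D \<rho> x by (subst mult.assoc[symmetric], intro mult_mono) auto
    also have "\<dots> \<le> ln m * x ^ 6" using lnm x by (intro mult_right_mono) auto
    finally show ?thesis using D m x by (simp add: field_simps)
  qed
  then have "sqrt (64 * \<rho> / x ^ 6) \<le> sqrt (ln m / (D * m powr (3/4)))" by simp
  moreover have "sqrt (64 * \<rho> / x ^ 6) = 8 * sqrt \<rho> / x ^ 3"
  proof (rule real_sqrt_unique)
    show "(8 * sqrt \<rho> / x ^ 3)\<^sup>2 = 64 * \<rho> / x ^ 6"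
      using \<rho> by (simp add: power_divide power_mult_distrib flip: power_mult)
  qed (use x \<rho> in simp)
  ultimately have "64 * sqrt \<rho> / x ^ 3 \<le> \<delta>" using psi by simp
  then have "64 * sqrt \<rho> \<le> \<delta> * x ^ 3" using x by (simp add: field_simps)
  then have "64 * sqrt \<rho> * x ^ 5 \<le> \<delta> * x ^ 3 * x ^ 5" using x by (intro mult_right_mono) auto
  then have "64 * sqrt \<rho> * x ^ 5 \<le> n * \<delta>" by (simp add: mult.assoc mult.commute[of \<delta>] x8 flip: power_add)
  moreover have "sqrt \<rho> * (5 * JS) \<le> sqrt \<rho> * x ^ 5" using JS5 \<rho> by (intro mult_left_mono) auto
  moreover have "0 \<le> sqrt \<rho> * JS" using JS \<rho> by simp
  ultimately show ?thesis by linarith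
qed

text \<open>By integrality each coordinate is at most its square in absolute value. This ties the
  mean \<open>l1\<close> length of a jump to the trace of \<open>sigma2\<close> without an
  additional dimension factor.\<close>

lemma l1_le_norm_square: "l1 J \<le> (norm (rvec J))\<^sup>2"
proof -
  have "\<bar>real_of_int z\<bar> \<le> (real_of_int z)\<^sup>2" for z
  proof -
    have "\<bar>z\<bar> * 1 \<le> \<bar>z\<bar> * \<bar>z\<bar>"
    proof (cases "z = 0")
      case False
      then show ?thesis by (intro mult_left_mono) auto
    qed simp
    then have "\<bar>z\<bar> \<le> z\<^sup>2" by (simp add: power2_eq_square)
    then show ?thesis by (metis of_int_abs of_int_le_iff of_int_power)
  qed
  then have "l1 J \<le> (\<Sum>i\<in>UNIV. (real_of_int (J $ i))\<^sup>2)" unfolding l1_def by (intro sum_mono)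
  also have "\<dots> = (norm (rvec J))\<^sup>2"
    by (simp add: rvec_def norm_vec_def L2_set_def sum_nonneg)
  finally show ?thesis .
qed

lemma l1_le_norm:
  fixes J :: "int^'d"
  shows "l1 J \<le> sqrt (real CARD('d)) * norm (rvec J)"
proof -
  have "l1 J = (\<Sum>i\<in>UNIV. \<bar>1\<bar> * \<bar>rvec J $ i\<bar>)" by (simp add: l1_def rvec_def)
  also have "\<dots> \<le> L2_set (\<lambda>_. 1) (UNIV::'d set) * L2_set (($) (rvec J)) UNIV"
    by (rule L2_set_mult_ineq)
  also have "\<dots> = sqrt (real CARD('d)) * norm (rvec J)"
    by (simp add: L2_set_def norm_vec_def)
  finally show ?thesis .
qed

subsection \<open>Moment bounds for probability mass functions\<close>

text \<open>Turns a moment bound stated as a nonnegative integral, which carries its own finiteness,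
  into a bound for ordinary finite sums.\<close>

lemma pmf_sum_le_nn_integral:
  fixes f :: "'a \<Rightarrow> real"
  assumes fin: "finite B" and f: "\<And>w. 0 \<le> f w" and K: "0 \<le> K"
    and le: "(\<integral>\<^sup>+ w. ennreal (f w) \<partial>measure_pmf p) \<le> ennreal K"
  shows "(\<Sum>w\<in>B. pmf p w * f w) \<le> K"
proof -
  have "ennreal (\<Sum>w\<in>B. pmf p w * f w) = (\<Sum>w\<in>B. ennreal (f w) * indicator B w * ennreal (pmf p w))"
    using f by (subst sum_ennreal[symmetric]) (auto intro!: sum.cong simp: ennreal_mult' mult.commute)
  also have "\<dots> = (\<integral>\<^sup>+ w. ennreal (f w) * indicator B w \<partial>measure_pmf p)"
    by (rule nn_integral_measure_pmf_support[symmetric]) (use fin in auto)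
  also have "\<dots> \<le> (\<integral>\<^sup>+ w. ennreal (f w) \<partial>measure_pmf p)"
    by (intro nn_integral_mono) (auto simp: indicator_def)
  also note le
  finally show ?thesis using K by simp
qed

lemma pmf_Markov:
  fixes f :: "'a \<Rightarrow> real"
  assumes a: "0 \<le> a" and fa: "\<And>w. w \<in> S \<Longrightarrow> a \<le> f w" and K: "0 \<le> K"
    and le: "(\<integral>\<^sup>+ w. ennreal (f w) \<partial>measure_pmf p) \<le> ennreal K"
  shows "a * measure_pmf.prob p S \<le> K"
proof -
  have "ennreal (a * measure_pmf.prob p S) = ennreal a * emeasure (measure_pmf p) S"
    using a by (simp add: ennreal_mult measure_pmf.emeasure_eq_measure)
  also have "\<dots> = (\<integral>\<^sup>+ w. ennreal a * indicator S w \<partial>measure_pmf p)"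
    by (subst nn_integral_cmult) auto
  also have "\<dots> \<le> (\<integral>\<^sup>+ w. ennreal (f w) \<partial>measure_pmf p)"
    by (intro nn_integral_mono) (auto simp: indicator_def fa ennreal_leI)
  also note le
  finally show ?thesis using K by simp
qed

text \<open>Cauchy-Schwarz for total weight at most 1, in the form of the inequality
  \<open>x w \<le> (s + (x w)\<^sup>2 / s) / 2\<close> with the target bound \<open>s\<close> as
  parameter.\<close>

lemma weighted_sum_le_sqrt:
  fixes x :: "'a \<Rightarrow> real"
  assumes p0: "\<And>w. 0 \<le> p w" and p1: "(\<Sum>w\<in>B. p w) \<le> 1" and s: "0 < s"
    and le: "(\<Sum>w\<in>B. p w * (x w)\<^sup>2) \<le> s\<^sup>2"
  shows "(\<Sum>w\<in>B. p w * x w) \<le> s"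
proof -
  have "x w \<le> (s + (x w)\<^sup>2 / s) / 2" for w
  proof -
    have "0 \<le> (x w - s)\<^sup>2 / s" using s by simp
    then show ?thesis using s by (simp add: power2_eq_square field_simps)
  qed
  then have "(\<Sum>w\<in>B. p w * x w) \<le> (\<Sum>w\<in>B. p w * ((s + (x w)\<^sup>2 / s) / 2))"
    by (intro sum_mono mult_left_mono p0)
  also have "\<dots> = (s * (\<Sum>w\<in>B. p w) + (\<Sum>w\<in>B. p w * (x w)\<^sup>2) / s) / 2"
    by (simp add: sum_distrib_left sum_divide_distrib sum.distrib[symmetric] field_simps)
  also have "\<dots> \<le> (s * 1 + s\<^sup>2 / s) / 2"
    using p1 le s by (intro divide_right_mono add_mono mult_left_mono) auto
  also have "\<dots> = s" using s by (simp add: power2_eq_square)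
  finally show ?thesis .
qed

subsection \<open>Decomposition of the generator difference\<close>

definition jump_diff :: "(int^'d \<Rightarrow> real) \<Rightarrow> int^'d \<Rightarrow> int^'d \<Rightarrow> real" where
  "jump_diff h J w = (\<Sum>j\<in>UNIV. real_of_int (J $ j) * Delta j h w)"

definition Taylor1_rem :: "(int^'d \<Rightarrow> real) \<Rightarrow> int^'d \<Rightarrow> int^'d \<Rightarrow> real" where
  "Taylor1_rem h J w = h (w + J) - h w - jump_diff h J w"

text \<open>The Taylor bound is applied to the averaged function \<open>a\<close>, not to
  \<open>h\<close> around each \<open>w\<close>. Averaging commutes with the difference operators,
  and the second differences of \<open>a\<close> vary little under shifts by the total variation
  hypothesis, which gives nothing for a single \<open>w\<close>.\<close>

lemma Taylor2_expectation_bound: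
  fixes h :: "int^'d \<Rightarrow> real"
  assumes finB: "finite B" and finC: "finite C"
    and BC: "\<And>w y. w \<in> B \<Longrightarrow> norm (rvec y) \<le> norm (rvec J) \<Longrightarrow> w + y \<in> C"
    and M: "\<And>j k x. x \<in> C \<Longrightarrow> \<bar>Delta2 j k h x\<bar> \<le> M" and M0: "0 \<le> M"
    and tv: "\<And>j. dTV p (map_pmf (\<lambda>w. w + ee j) p) \<le> \<epsilon>" and \<epsilon>: "0 \<le> \<epsilon>"
  shows "\<bar>\<Sum>w\<in>B. pmf p w * (Taylor1_rem h J w - quad_part (\<lambda>j k. Delta2 j k h w) J)\<bar>
    \<le> M * \<epsilon> * (l1 J ^ 3 - coord_sum J) + 2 * M * measure_pmf.prob p (- B) * (l1 J)\<^sup>2"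
proof -
  define a where "a y = (\<Sum>w\<in>B. pmf p w * h (w + y))" for y
  have D1: "Delta j a y = (\<Sum>w\<in>B. pmf p w * Delta j h (w + y))" for j y
    by (simp add: a_def Delta_def sum_subtractf[symmetric] algebra_simps)
  have D2: "Delta2 j k a y = (\<Sum>w\<in>B. pmf p w * Delta2 j k h (w + y))" for j k y
    by (simp add: Delta2_def Delta_def[of j] D1 sum_subtractf[symmetric] algebra_simps)
  have BsubC: "B \<subseteq> C" using BC[of _ 0] by (auto simp: rvec_def zero_vec_def[symmetric])
  have S: "\<bar>Delta2 j k a y - Delta2 j k a 0\<bar> \<le> 2 * (M * \<epsilon>) * l1 y + 2 * M * measure_pmf.prob p (- B)"
    if "norm (rvec y) \<le> norm (rvec J)" for j k y
    using shift_restricted_sum_bound[of B C y "Delta2 j k h" M p \<epsilon>] finB finC BsubC BC[OF _ that] M M0 tv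
    by (simp add: D2 mult.assoc)
  have swap: "(\<Sum>j\<in>UNIV. u j * (\<Sum>w\<in>B. pmf p w * X w j)) = (\<Sum>w\<in>B. pmf p w * (\<Sum>j\<in>UNIV. u j * X w j))"
    for u :: "'d \<Rightarrow> real" and X
    unfolding sum_distrib_left by (subst sum.swap) (simp add: algebra_simps)
  have "(\<Sum>w\<in>B. pmf p w * (Taylor1_rem h J w - quad_part (\<lambda>j k. Delta2 j k h w) J))
     = a J - a 0 - (\<Sum>j\<in>UNIV. real_of_int (J $ j) * Delta j a 0) - quad_part (\<lambda>j k. Delta2 j k a 0) J"
    unfolding D1 D2 quad_part_def swap a_def Taylor1_rem_def jump_diff_def
    by (simp add: sum_subtractf sum_divide_distrib[of _ B] right_diff_distrib diff_divide_distrib)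
  moreover have "0 \<le> 2 * M * measure_pmf.prob p (- B)" using M0 by simp
  moreover have "0 \<le> M * \<epsilon>" using M0 \<epsilon> by simp
  ultimately show ?thesis
    using lattice_Taylor2_bound[of "norm (rvec J)" a "M * \<epsilon>", OF S] by simp
qed

lemma Taylor1_rem_bound:
  fixes h :: "int^'d \<Rightarrow> real"
  assumes "\<And>j k y. norm (rvec y) \<le> norm (rvec J) \<Longrightarrow> \<bar>Delta2 j k h (w + y)\<bar> \<le> M" and "0 \<le> M"
  shows "\<bar>Taylor1_rem h J w\<bar> \<le> M * (l1 J)\<^sup>2"
  using lattice_Taylor1_bound[of "norm (rvec J)" "\<lambda>y. h (w + y)" M J] assms
  by (simp add: Delta2_shift Delta_shift Taylor1_rem_def jump_diff_def)

lemma jump_diff_bound: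
  assumes "\<And>j. \<bar>Delta j h w\<bar> \<le> M"
  shows "\<bar>jump_diff h J w\<bar> \<le> l1 J * M"
  unfolding jump_diff_def l1_def sum_distrib_right
  by (rule order_trans[OF sum_abs sum_mono]) (simp add: abs_mult mult_left_mono assms)

text \<open>Summed against the rates, the diagonal correction in \<open>quad_part\<close> becomes a
  combination of drift coordinates, all zero; the product terms form the covariance matrix.\<close>

lemma sum_quad_part:
  fixes D :: "'d::finite \<Rightarrow> 'd \<Rightarrow> real" and Js :: "(int^'d) set"
  assumes sym: "\<And>j k. D j k = D k j" and drift: "Fdrift Js g c = 0"
  shows "(\<Sum>J\<in>Js. g J c * quad_part D J) = trace (sigma2 Js g c ** (\<chi> j k. D j k)) / 2"
proof -
  have F: "(\<Sum>J\<in>Js. g J c * real_of_int (J $ j)) = 0" for j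
    using arg_cong[OF drift, of "\<lambda>v. v $ j"] by (simp add: Fdrift_def rvec_def)
  have "(\<Sum>J\<in>Js. g J c * (\<Sum>j\<in>UNIV. real_of_int (J $ j) * D j j))
      = (\<Sum>j\<in>UNIV. (\<Sum>J\<in>Js. g J c * real_of_int (J $ j)) * D j j)"
    unfolding sum_distrib_left sum_distrib_right by (subst sum.swap) (simp add: algebra_simps)
  then have 1: "(\<Sum>J\<in>Js. g J c * (\<Sum>j\<in>UNIV. real_of_int (J $ j) * D j j)) = 0" by (simp add: F)
  have "trace (sigma2 Js g c ** (\<chi> j k. D j k))
      = (\<Sum>i\<in>UNIV. \<Sum>k\<in>UNIV. \<Sum>J\<in>Js. real_of_int (J $ i) * real_of_int (J $ k) * g J c * D k i)"
    by (simp add: trace_def matrix_matrix_mult_def sigma2_def sum_distrib_right)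
  also have "\<dots> = (\<Sum>i\<in>UNIV. \<Sum>J\<in>Js. \<Sum>k\<in>UNIV. real_of_int (J $ i) * real_of_int (J $ k) * g J c * D k i)"
    by (intro sum.cong refl) (rule sum.swap)
  also have "\<dots> = (\<Sum>J\<in>Js. \<Sum>i\<in>UNIV. \<Sum>k\<in>UNIV. real_of_int (J $ i) * real_of_int (J $ k) * g J c * D k i)"
    by (rule sum.swap)
  also have "\<dots> = (\<Sum>J\<in>Js. g J c * (\<Sum>i\<in>UNIV. real_of_int (J $ i) * (\<Sum>k\<in>UNIV. real_of_int (J $ k) * D i k)))"
    unfolding sum_distrib_left by (intro sum.cong refl) (subst sym, simp add: algebra_simps)
  finally have 2: "(\<Sum>J\<in>Js. g J c * (\<Sum>i\<in>UNIV. real_of_int (J $ i) * (\<Sum>k\<in>UNIV. real_of_int (J $ k) * D i k)))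
      = trace (sigma2 Js g c ** (\<chi> j k. D j k))" by simp
  have "(\<Sum>J\<in>Js. g J c * quad_part D J)
     = ((\<Sum>J\<in>Js. g J c * (\<Sum>i\<in>UNIV. real_of_int (J $ i) * (\<Sum>k\<in>UNIV. real_of_int (J $ k) * D i k)))
       - (\<Sum>J\<in>Js. g J c * (\<Sum>j\<in>UNIV. real_of_int (J $ j) * D j j))) / 2"
    unfolding sum_subtractf[symmetric] sum_divide_distrib[of _ Js]
    by (simp only: quad_part_def right_diff_distrib times_divide_eq_right)
  then show ?thesis by (simp add: 1 2)
qed

text \<open>The rate at \<open>c + \<xi>\<close> is expanded to first order against
  \<open>jump_diff\<close> and to order zero against \<open>Taylor1_rem\<close>. The order-zero part
  against \<open>jump_diff\<close> is the drift at \<open>c\<close> and vanishes; the first-order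
  part is the drift term of \<open>simp_A\<close>, because
  \<open>rvec w - real n *\<^sub>R c\<close> is \<open>n\<close> times \<open>\<xi>\<close>.\<close>

lemma generator_difference:
  fixes Js :: "(int^'d) set" and g :: "int^'d \<Rightarrow> real^'d \<Rightarrow> real" and Dg :: "int^'d \<Rightarrow> real^'d"
  assumes n: "0 < n" and drift: "Fdrift Js g c = 0"
    and A: "\<And>y. A *v y = (\<Sum>J\<in>Js. (Dg J \<bullet> y) *\<^sub>R rvec J)"
    and inside: "w \<in> Btilde Sig n \<delta> c" "\<And>J. J \<in> Js \<Longrightarrow> w + J \<in> Btilde Sig n \<delta> c"
    and \<xi>: "\<xi> = inverse (real n) *\<^sub>R rvec w - c"
  shows "gen_A Js g Sig n \<delta> c h w - simp_A (sigma2 Js g c) A n c h w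
    = real n * (\<Sum>J\<in>Js. (g J (c + \<xi>) - g J c - Dg J \<bullet> \<xi>) * jump_diff h J w)
      + real n * (\<Sum>J\<in>Js. (g J (c + \<xi>) - g J c) * Taylor1_rem h J w)
      + real n * (\<Sum>J\<in>Js. g J c * (Taylor1_rem h J w - quad_part (\<lambda>j k. Delta2 j k h w) J))"
proof -
  have gen: "gen_A Js g Sig n \<delta> c h w
      = real n * (\<Sum>J\<in>Js. g J (c + \<xi>) * (jump_diff h J w + Taylor1_rem h J w))"
    unfolding gen_A_def Taylor1_rem_def \<xi>
    by (intro arg_cong[where f = "(*) (real n)"] sum.cong refl) (simp add: gdelta_def inside)
  have dot: "(\<chi> j. Delta j h w) \<bullet> rvec J = jump_diff h J w" for J
    by (simp add: jump_diff_def inner_vec_def rvec_def mult.commute)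
  have y: "rvec w - real n *\<^sub>R c = real n *\<^sub>R \<xi>" using n by (simp add: \<xi> algebra_simps)
  have lin: "(\<chi> j. Delta j h w) \<bullet> (A *v (rvec w - real n *\<^sub>R c))
      = real n * (\<Sum>J\<in>Js. (Dg J \<bullet> \<xi>) * jump_diff h J w)"
    unfolding y A by (simp add: inner_sum_right dot sum_distrib_left mult.assoc)
  have "(\<chi> j. Delta j h w) \<bullet> Fdrift Js g c = (\<Sum>J\<in>Js. g J c * jump_diff h J w)"
    by (simp add: Fdrift_def inner_sum_right dot)
  then have zero: "(\<Sum>J\<in>Js. g J c * jump_diff h J w) = 0" by (simp add: drift)
  have quad: "real n / 2 * trace (sigma2 Js g c ** (\<chi> j k. Delta2 j k h w))
      = real n * (\<Sum>J\<in>Js. g J c * quad_part (\<lambda>j k. Delta2 j k h w) J)"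
    using sum_quad_part[of "\<lambda>j k. Delta2 j k h w" Js g c, OF Delta2_commute drift] by simp
  have "gen_A Js g Sig n \<delta> c h w - simp_A (sigma2 Js g c) A n c h w
     = real n * ((\<Sum>J\<in>Js. g J (c + \<xi>) * (jump_diff h J w + Taylor1_rem h J w))
        - (\<Sum>J\<in>Js. g J c * quad_part (\<lambda>j k. Delta2 j k h w) J)
        - (\<Sum>J\<in>Js. (Dg J \<bullet> \<xi>) * jump_diff h J w) - (\<Sum>J\<in>Js. g J c * jump_diff h J w))"
    unfolding gen simp_A_def lin quad zero by (simp add: algebra_simps)
  also have "\<dots> = real n * ((\<Sum>J\<in>Js. (g J (c + \<xi>) - g J c - Dg J \<bullet> \<xi>) * jump_diff h J w)
      + (\<Sum>J\<in>Js. (g J (c + \<xi>) - g J c) * Taylor1_rem h J w)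
      + (\<Sum>J\<in>Js. g J c * (Taylor1_rem h J w - quad_part (\<lambda>j k. Delta2 j k h w) J)))"
    unfolding sum_subtractf[symmetric] sum.distrib[symmetric]
    by (intro arg_cong[where f = "(*) (real n)"] sum.cong refl) (simp add: algebra_simps)
  finally show ?thesis by (simp add: distrib_left)
qed

text \<open>\<open>D\<close> stands for the square root of the dimension, so that all exponents are
  natural numbers. The bound on \<open>T1\<close> is relaxed by a factor \<open>D\<close>, and the
  tail part of \<open>T3\<close> from constant 18 to 32; the other terms match exactly.\<close>

lemma error_terms_combine:
  fixes D n \<Lambda> L1 L2 M1 M2 lm v \<epsilon> S3 P \<delta>' T1 T2 T3 :: real
  assumes D: "1 \<le> D" and pos: "0 < n" "0 < \<Lambda>" "0 < lm" "0 < v" "0 < \<delta>'"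
    and nn: "0 \<le> L2" "0 \<le> M1" "0 \<le> M2"
    and T1: "T1 \<le> n * (L2 / 2 * M1 * (D\<^sup>2 * \<Lambda>) * (lm * D\<^sup>2 * v / n))"
    and T2: "T2 \<le> n * (L1 * M2 * (D\<^sup>2 * (D\<^sup>2 * \<Lambda>)) * sqrt (lm * D\<^sup>2 * v / n))"
    and T3: "T3 \<le> n * (M2 * \<epsilon> * (D ^ 3 * S3) + 2 * M2 * P * (D\<^sup>2 * (D\<^sup>2 * \<Lambda>)))"
    and P: "P \<le> 9 * D\<^sup>2 * v / (n * \<delta>'\<^sup>2)"
  shows "T1 + T2 + T3 \<le> D ^ 5 * \<Lambda> * (1/2 * L2 * lm * v * M1 + n * M2 *
     (L1 * sqrt (v * lm) * (1 / sqrt n) + D * (S3 / D ^ 3 / \<Lambda>) * \<epsilon> + 32 * D * v / (n * \<delta>'\<^sup>2)))"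
proof -
  have "D ^ 4 \<le> D ^ 5" using D by (intro power_increasing) auto
  then have "D ^ 4 * (L2 / 2 * M1 * \<Lambda> * lm * v) \<le> D ^ 5 * (L2 / 2 * M1 * \<Lambda> * lm * v)"
    using pos nn by (intro mult_right_mono) auto
  moreover have "n * (L2 / 2 * M1 * (D\<^sup>2 * \<Lambda>) * (lm * D\<^sup>2 * v / n)) = D ^ 4 * (L2 / 2 * M1 * \<Lambda> * lm * v)"
    using pos by (simp add: field_simps eval_nat_numeral)
  ultimately have 1: "T1 \<le> D ^ 5 * \<Lambda> * (1/2 * L2 * lm * v * M1)"
    using T1 by (simp add: algebra_simps)
  have "sqrt (lm * D\<^sup>2 * v / n) = D * sqrt (v * lm) * (1 / sqrt n)"
    using D by (simp add: real_sqrt_mult real_sqrt_divide)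
  then have 2: "T2 \<le> D ^ 5 * \<Lambda> * (n * M2 * (L1 * sqrt (v * lm) * (1 / sqrt n)))"
    using T2 by (simp add: algebra_simps eval_nat_numeral)
  have "2 * M2 * P * (D\<^sup>2 * (D\<^sup>2 * \<Lambda>)) \<le> 2 * M2 * (9 * D\<^sup>2 * v / (n * \<delta>'\<^sup>2)) * (D\<^sup>2 * (D\<^sup>2 * \<Lambda>))"
    using P pos nn by (intro mult_right_mono mult_left_mono) auto
  also have "\<dots> = 18 * (D ^ 6 * \<Lambda> * M2 * (v / (n * \<delta>'\<^sup>2)))"
    by (simp add: eval_nat_numeral field_simps)
  also have "\<dots> \<le> 32 * (D ^ 6 * \<Lambda> * M2 * (v / (n * \<delta>'\<^sup>2)))"
    using pos nn D by (intro mult_right_mono mult_nonneg_nonneg) auto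
  finally have "n * (2 * M2 * P * (D\<^sup>2 * (D\<^sup>2 * \<Lambda>))) \<le> n * (32 * (D ^ 6 * \<Lambda> * M2 * (v / (n * \<delta>'\<^sup>2))))"
    using pos by (intro mult_left_mono) auto
  then have "T3 \<le> n * (M2 * \<epsilon> * (D ^ 3 * S3)) + n * (32 * (D ^ 6 * \<Lambda> * M2 * (v / (n * \<delta>'\<^sup>2))))"
    using T3 by (simp only: distrib_left)
  also have "n * (M2 * \<epsilon> * (D ^ 3 * S3)) = D ^ 5 * \<Lambda> * (n * M2 * (D * (S3 / D ^ 3 / \<Lambda>) * \<epsilon>))"
    using D pos by (simp add: field_simps eval_nat_numeral)
  also have "n * (32 * (D ^ 6 * \<Lambda> * M2 * (v / (n * \<delta>'\<^sup>2)))) = D ^ 5 * \<Lambda> * (n * M2 * (32 * D * v / (n * \<delta>'\<^sup>2)))"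
    by (simp add: eval_nat_numeral)
  finally show ?thesis using 1 2 by (simp only: distrib_left)
qed

lemma weighted_sum_abs_le:
  fixes f x p :: "'a \<Rightarrow> real"
  assumes f: "\<And>w. w \<in> B \<Longrightarrow> \<bar>f w\<bar> \<le> K * x w" and p: "\<And>w. 0 \<le> p w"
  shows "\<bar>\<Sum>w\<in>B. p w * f w\<bar> \<le> K * (\<Sum>w\<in>B. p w * x w)"
proof -
  have "\<bar>\<Sum>w\<in>B. p w * f w\<bar> \<le> (\<Sum>w\<in>B. p w * (K * x w))"
    by (rule order_trans[OF sum_abs sum_mono]) (simp add: abs_mult p f mult_left_mono)
  then show ?thesis by (simp add: sum_distrib_left mult_ac)
qed

section \<open>Covariance of the jumps and derivative of the drift\<close>

lemma trace_sigma2: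
  fixes Js :: "(int^'d) set"
  shows "trace (sigma2 Js g c) = (\<Sum>J\<in>Js. g J c * (norm (rvec J))\<^sup>2)"
proof -
  have "(norm (rvec J))\<^sup>2 = (\<Sum>i\<in>UNIV. (real_of_int (J $ i))\<^sup>2)" for J :: "int^'d"
    by (simp add: rvec_def norm_vec_def L2_set_def sum_nonneg)
  then show ?thesis
    unfolding trace_def sigma2_def
    by (simp add: sum_distrib_left sum.swap[of _ UNIV] power2_eq_square algebra_simps)
qed

lemma inner_sigma2:
  fixes Js :: "(int^'d) set"
  shows "x \<bullet> (sigma2 Js g c *v x) = (\<Sum>J\<in>Js. g J c * (rvec J \<bullet> x)\<^sup>2)"
proof -
  have "sigma2 Js g c *v x = (\<Sum>J\<in>Js. (g J c * (rvec J \<bullet> x)) *\<^sub>R rvec J)"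
    unfolding vec_eq_iff
  proof
    fix i
    show "(sigma2 Js g c *v x) $ i = (\<Sum>J\<in>Js. (g J c * (rvec J \<bullet> x)) *\<^sub>R rvec J) $ i"
      by (simp add: sigma2_def matrix_vector_mult_def rvec_def inner_vec_def sum_distrib_left
          sum_distrib_right sum.swap[of _ UNIV] algebra_simps)
  qed
  then show ?thesis
    by (simp add: inner_sum_right power2_eq_square inner_commute algebra_simps)
qed

lemma sigma2_symmetric: "symmetric_mat (sigma2 Js g c)"
  by (simp add: symmetric_mat_def sigma2_def transpose_def mult.commute)

text \<open>The unit jumps suffice: a nonzero vector has a nonzero coordinate \<open>j\<close>, and
  the jump \<open>- ee j\<close> then contributes a positive square.\<close>

lemma sigma2_pos_def:
  fixes Js :: "(int^'d) set"
  assumes fin: "finite Js" and g: "\<And>J x. g J x \<ge> 0"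
    and unit: "\<And>j. - ee j \<in> Js \<and> 0 < g (- ee j) c"
  shows "pos_def (sigma2 Js g c)"
  unfolding pos_def_def inner_sigma2
proof (intro allI impI)
  fix x :: "real^'d" assume "x \<noteq> 0"
  then obtain j where j: "x $ j \<noteq> 0" by (auto simp: vec_eq_iff)
  have "rvec (- ee j) = - axis j (1::real)" by (simp add: rvec_def ee_def axis_def vec_eq_iff)
  then have "rvec (- ee j) \<bullet> x = - (x $ j)" by (simp add: inner_axis')
  then have "0 < g (- ee j) c * (rvec (- ee j) \<bullet> x)\<^sup>2" using unit[of j] j by simp
  then show "0 < (\<Sum>J\<in>Js. g J c * (rvec J \<bullet> x)\<^sup>2)"
    using unit[of j] g by (intro sum_pos2[OF fin]) auto
qed

lemma JSmax_ge:
  fixes Sig :: "real^'d^'d"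
  assumes "symmetric_mat Sig" "pos_def Sig" "finite Js" "J \<in> Js"
  shows "normS Sig (rvec J) \<le> JSmax Js Sig"
  unfolding JSmax_def normS_eq_norm_inv_sqrt[OF assms(1,2)] using assms(3,4) by (intro Max_ge) auto

lemma drift_derivative_eq:
  fixes g :: "int^'d \<Rightarrow> real^'d \<Rightarrow> real"
  assumes A: "(Fdrift Js g has_derivative (\<lambda>y. A *v y)) (at c)"
    and D: "\<And>J. J \<in> Js \<Longrightarrow> (g J has_derivative (\<lambda>y. Dg J \<bullet> y)) (at c)"
  shows "A *v y = (\<Sum>J\<in>Js. (Dg J \<bullet> y) *\<^sub>R rvec J)"
proof -
  have "(Fdrift Js g has_derivative (\<lambda>y. \<Sum>J\<in>Js. (Dg J \<bullet> y) *\<^sub>R rvec J)) (at c)"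
    unfolding Fdrift_def[abs_def] by (intro has_derivative_sum has_derivative_scaleR_left D)
  from has_derivative_unique[OF A this] show ?thesis by (rule fun_cong)
qed

text \<open>For \<open>g_star\<close> equal to 0 the intended threshold \<open>n3\<close> is
  infinite, whereas division by zero yields 0 in HOL; \<open>gstar_pos\<close> rules this case out.
  \<open>Dg\<close> and \<open>D2g\<close> are parameters tied to \<open>g\<close> by the derivative
  assumptions on the closed ball. As a nonnegative integral, the moment in \<open>W_mom\<close> is
  bounded and thereby finite.\<close>

theorem theorem4p4:
  fixes Js :: "(int^'d) set"
    and g :: "int^'d \<Rightarrow> real^'d \<Rightarrow> real"
    and Dg :: "int^'d \<Rightarrow> real^'d \<Rightarrow> real^'d"
    and D2g :: "int^'d \<Rightarrow> real^'d \<Rightarrow> real^'d^'d"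
    and c :: "real^'d" and \<delta>0 :: real
    and A Sig :: "real^'d^'d"
    and n :: nat
    and p :: "(int^'d) pmf"
    and \<epsilon> v \<delta> \<delta>' :: real
    and h :: "int^'d \<Rightarrow> real"
  assumes n_ge: "real n \<ge> real CARD('d) ^ 4"
    and Js_fin: "finite Js"
    and g_nonneg: "\<And>J x. g J x \<ge> 0"
    and g_out: "\<And>J x. J \<notin> Js \<Longrightarrow> g J x = 0"
    and \<delta>0_pos: "\<delta>0 > 0"
    and G0: "Fdrift Js g c = 0"
    and A_def: "(Fdrift Js g has_derivative (\<lambda>y. A *v y)) (at c)"
    and G1: "\<forall>\<mu>\<in>complex_eigenvalues A. Re \<mu> < 0"
    and G2_D1: "\<And>J x. J \<in> Js \<Longrightarrow> x \<in> cball c \<delta>0 \<Longrightarrow>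
                   (g J has_derivative (\<lambda>y. Dg J x \<bullet> y)) (at x within cball c \<delta>0)"
    and G2_D2: "\<And>J x. J \<in> Js \<Longrightarrow> x \<in> cball c \<delta>0 \<Longrightarrow>
                   (Dg J has_derivative (\<lambda>y. D2g J x *v y)) (at x within cball c \<delta>0)"
    and G2_cont: "\<And>J. J \<in> Js \<Longrightarrow> continuous_on (cball c \<delta>0) (D2g J)"
    and G3: "\<exists>\<epsilon>0>0. \<forall>J\<in>Js. g J c > 0 \<and> (\<forall>x\<in>cball c \<delta>0. g J x \<ge> \<epsilon>0 * g J c)"
    and G4: "\<forall>j. \<exists>k :: int^'d \<Rightarrow> nat. (\<Sum>J\<in>Js. int (k J) *s J) = ee j"
    and Sig_sym: "symmetric_mat Sig"
    and Sig_pd: "pos_def Sig"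
    and Sig_lyap: "A ** Sig + Sig ** transpose A + sigma2 Js g c = 0"
    and \<epsilon>_pos: "\<epsilon> > 0" and v_pos: "v > 0"
    and W_mom: "(\<integral>\<^sup>+ w. ennreal ((normS Sig (rvec w - real n *\<^sub>R c))\<^sup>2) \<partial>measure_pmf p)
                  \<le> ennreal (real CARD('d) * v * real n)"
    and W_tv: "\<forall>j. dTV p (map_pmf (\<lambda>w. w + ee j) p) \<le> \<epsilon>"
    and \<delta>_le: "\<delta> \<le> \<delta>0 / sqrt (lam_max Sig)"
    and \<delta>'_pos: "0 < \<delta>'" and \<delta>'_le: "\<delta>' \<le> \<delta> / 2"
    and gstar_pos: "g_star g c A > 0"
    and n_ge3: "real n \<ge> n3 Js g c \<delta>0 Sig A"
    and n_ge_psi: "n \<ge> psi_inv Js g c \<delta>0 Sig (\<delta> / 2)"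
  shows "\<bar>measure_pmf.expectation p
            (\<lambda>w. (gen_A Js g Sig n \<delta> c h w - simp_A (sigma2 Js g c) A n c h w)
                 * indicator {X. normS Sig (rvec X - real n *\<^sub>R c) \<le> real n * \<delta>' / 3} w)\<bar>
         \<le> real CARD('d) powr (5/2) * Lambda_bar Js g c *
            (1/2 * L2 Js g D2g c \<delta>0 * lam_max Sig * v * normD1 Sig n c h (real n * \<delta> / 4)
             + real n * normD2 Sig n c h (real n * \<delta> / 4) *
               (L1 Js g Dg c \<delta>0 * sqrt (v * lam_max Sig) * real n powr (-1/2)
                + sqrt (real CARD('d)) * (gamma_bar Js g c / Lambda_bar Js g c) * \<epsilon>
                + 32 * sqrt (real CARD('d)) * v / (real n * \<delta>'\<^sup>2)))"
proof -
  let ?d = "real CARD('d)"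
  let ?N = "\<lambda>w. normS Sig (rvec w - real n *\<^sub>R c)"
  let ?lm = "lam_max Sig"
  note lam = lam_pos[OF Sig_sym Sig_pd]
  have d1: "1 \<le> ?d" by (simp add: Suc_leI)
  have \<delta>: "0 < \<delta>" using \<delta>'_pos \<delta>'_le by simp
  have gc: "0 < g J c" if "J \<in> Js" for J using G3 that by blast
  have cb: "c \<in> cball c \<delta>0" using \<delta>0_pos by simp

  \<comment> \<open>Unit jumps and positivity of the covariance\<close>
  have unit: "- ee j \<in> Js \<and> 0 < g (- ee j) c" for j
  proof -
    \<comment> \<open>Positivity of the minimum passes to each \<open>g_low\<close>, and
      \<open>g_out\<close> then places every \<open>- ee j\<close> in \<open>Js\<close>.\<close>
    have "g_star g c A \<le> min (g_low g c j) (G_up g c A j)"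
      unfolding g_star_def by (intro Min_le) auto
    then have "0 < g (- ee j) c" using gstar_pos by (simp add: g_low_def)
    then show ?thesis using g_out[of "- ee j" c] by fastforce
  qed
  then have Js_ne: "Js \<noteq> {}" by blast
  have \<sigma>_pd: "pos_def (sigma2 Js g c)"
    by (rule sigma2_pos_def) (use Js_fin g_nonneg unit in auto)

  \<comment> \<open>Regularity of the rates and their normalised constants\<close>
  have Dg_cont: "continuous_on (cball c \<delta>0) (Dg J)" if "J \<in> Js" for J
    using G2_D2[OF that] by (rule has_derivative_continuous_on)
  have g_cont: "continuous_on (cball c \<delta>0) (g J)" if "J \<in> Js" for J
    using G2_D1[OF that] by (rule has_derivative_continuous_on)
  \<comment> \<open>The supremum includes the point \<open>c\<close> itself, where the normalised
    rate is 1.\<close>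
  have L0: "1 \<le> L0 Js g c \<delta>0"
  proof -
    obtain J where J: "J \<in> Js" using Js_ne by blast
    obtain K where "\<forall>x\<in>cball c \<delta>0. norm (g J x) \<le> K"
      using compact_norm_bdd_above[OF compact_cball g_cont[OF J]] by blast
    then have "bdd_above (g J ` cball c \<delta>0)" by (intro bdd_aboveI2[where M = K]) fastforce
    from Max_SUP_div_bound[where F = g and G = "\<lambda>J. g J c", OF Js_fin J gc[OF J] cb this]
    have "1 * g J c \<le> L0 Js g c \<delta>0 * g J c" by (simp add: L0_def)
    then show ?thesis using gc[OF J] by (simp only: mult_le_cancel_right_pos)
  qed
  have L1: "norm (Dg J x) \<le> L1 Js g Dg c \<delta>0 * g J c" if J: "J \<in> Js" and x: "x \<in> cball c \<delta>0" for J x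
  proof -
    obtain K where "\<forall>x\<in>cball c \<delta>0. norm (Dg J x) \<le> K"
      using compact_norm_bdd_above[OF compact_cball Dg_cont[OF J]] by blast
    then have "bdd_above ((\<lambda>x. norm (Dg J x)) ` cball c \<delta>0)" by (intro bdd_aboveI2[where M = K]) auto
    from Max_SUP_div_bound[where F = "\<lambda>J x. norm (Dg J x)" and G = "\<lambda>J. g J c", OF Js_fin J gc[OF J] x this]
    show ?thesis by (simp add: L1_def)
  qed
  have L2: "onorm (\<lambda>y. D2g J x *v y) \<le> L2 Js g D2g c \<delta>0 * g J c" if J: "J \<in> Js" and x: "x \<in> cball c \<delta>0" for J x
  proof -
    obtain K where K: "\<forall>x\<in>cball c \<delta>0. norm (D2g J x) \<le> K"
      using compact_norm_bdd_above[OF compact_cball G2_cont[OF J]] by blast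
    have "bdd_above ((\<lambda>x. onorm (\<lambda>y. D2g J x *v y)) ` cball c \<delta>0)"
    proof (rule bdd_aboveI2)
      fix x assume "x \<in> cball c \<delta>0"
      then show "onorm (\<lambda>y. D2g J x *v y) \<le> ?d * K"
        using K by (intro order_trans[OF onorm_matrix_le] mult_left_mono) auto
    qed
    from Max_SUP_div_bound[where F = "\<lambda>J x. onorm (\<lambda>y. D2g J x *v y)" and G = "\<lambda>J. g J c", OF Js_fin J gc[OF J] x this]
    show ?thesis by (simp add: L2_def)
  qed
  have L1_nn: "0 \<le> L1 Js g Dg c \<delta>0" and L2_nn: "0 \<le> L2 Js g D2g c \<delta>0"
  proof -
    obtain J where J: "J \<in> Js" using Js_ne by blast
    have "0 \<le> L1 Js g Dg c \<delta>0 * g J c" using L1[OF J cb] norm_ge_zero order_trans by blast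
    then show "0 \<le> L1 Js g Dg c \<delta>0" using gc[OF J] by (simp add: zero_le_mult_iff)
    have "0 \<le> onorm (\<lambda>y. D2g J c *v y)" by (rule onorm_pos_le) (simp add: linear_linear)
    then have "0 \<le> L2 Js g D2g c \<delta>0 * g J c" using L2[OF J cb] by linarith
    then show "0 \<le> L2 Js g D2g c \<delta>0" using gc[OF J] by (simp add: zero_le_mult_iff)
  qed

  \<comment> \<open>Size of the jumps relative to the local ball\<close>
  have JS_pos: "0 < JSmax Js Sig"
  proof -
    let ?e = "rvec (- ee undefined :: int^'d)"
    have "?e $ undefined = -1" by (simp add: rvec_def ee_def axis_def)
    then have "?e \<noteq> 0" by (metis zero_index zero_neq_neg_one)
    then have "0 < (norm ?e)\<^sup>2" by simp
    also have "\<dots> \<le> ?lm * (normS Sig ?e)\<^sup>2" by (rule norm_le_normS[OF Sig_sym Sig_pd])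
    finally have "normS Sig ?e \<noteq> 0" by auto
    then have "0 < normS Sig ?e" using normS_nonneg[OF Sig_sym Sig_pd, of ?e] by simp
    also have "\<dots> \<le> JSmax Js Sig" using unit by (intro JSmax_ge[OF Sig_sym Sig_pd Js_fin]) auto
    finally show ?thesis .
  qed
  have \<rho>\<sigma>: "1 \<le> rho (sigma2 Js g c)" using lam_pos(4)[OF sigma2_symmetric \<sigma>_pd] .
  define \<theta> where "\<theta> = theta1 Js g c \<delta>0 Sig"
  have d\<theta>: "?d * \<theta> = min (1 / (3 * (JSmax Js Sig / ?d) * delta_star \<delta>0 Sig))
      (min (1 / (64 * L0 Js g c \<delta>0 * rho (sigma2 Js g c) * rho Sig)) (1 / (4 * (JSmax Js Sig / ?d) ^ 2)))"
    by (simp add: \<theta>_def theta1_def Let_def)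
  have "0 < ?d * \<theta>"
    unfolding d\<theta> using JS_pos L0 \<rho>\<sigma> lam \<delta>0_pos by (simp add: delta_star_def)
  then have \<theta>: "0 < \<theta>" by (simp add: zero_less_mult_iff)
  \<comment> \<open>The second entry of the minimum in \<open>theta1\<close>, after dropping two
    factors that are at least 1.\<close>
  have \<theta>\<rho>: "?d * \<theta> \<le> 1 / (64 * rho Sig)"
  proof -
    have "1 * 1 \<le> L0 Js g c \<delta>0 * rho (sigma2 Js g c)" using L0 \<rho>\<sigma> by (intro mult_mono) auto
    then have "64 * rho Sig * 1 \<le> 64 * rho Sig * (L0 Js g c \<delta>0 * rho (sigma2 Js g c))"
      using lam by (intro mult_left_mono) auto
    then have "1 / (64 * L0 Js g c \<delta>0 * rho (sigma2 Js g c) * rho Sig) \<le> 1 / (64 * rho Sig)"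
      using lam by (intro divide_left_mono mult_pos_pos) (use L0 \<rho>\<sigma> in \<open>auto simp: algebra_simps\<close>)
    then show ?thesis unfolding d\<theta> by linarith
  qed
  define m where "m = psi_inv Js g c \<delta>0 Sig (\<delta> / 2)"
  have m: "4 \<le> m" "psi Js g c \<delta>0 Sig (real m) \<le> \<delta> / 2"
    using psi_inv_props[of Js g c \<delta>0 Sig "\<delta> / 2"] \<theta> \<delta> by (simp_all add: \<theta>_def m_def)
  have mn: "m \<le> n" using n_ge_psi by (simp add: m_def)
  have n: "0 < n" using m mn by simp
  have radius: "sqrt (rho Sig) * JSmax Js Sig \<le> real n * \<delta> / 12"
  proof (rule jump_radius_bound)
    let ?j = "5 * (JSmax Js Sig / ?d)"
    have "?j * 1 \<le> ?j * max 1 (sqrt (?d * \<theta>))"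
      using JS_pos by (intro mult_left_mono) auto
    then have "?j powr (8/3) \<le> (?j * max 1 (sqrt (?d * \<theta>))) powr (8/3)"
      using JS_pos by (intro powr_mono2) auto
    also have "\<dots> \<le> n3 Js g c \<delta>0 Sig A" by (simp add: n3_def \<theta>_def)
    finally show "?j powr (8/3) \<le> real n" using n_ge3 by linarith
    show "4 * sqrt (ln (real m) / (?d * \<theta> * real m powr (3/4))) \<le> \<delta> / 2"
      using m(2) by (simp add: psi_def \<theta>_def)
  qed (use d1 n_ge JS_pos m mn \<theta> \<theta>\<rho> lam in auto)

  \<comment> \<open>The ball of the indicator and the ball of the norms\<close>
  define B where "B = {X. ?N X \<le> real n * \<delta>' / 3}"
  define C where "C = {X. ?N X \<le> real n * \<delta> / 4}"
  have finB: "finite B" and finC: "finite C"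
    unfolding B_def C_def by (rule finite_lattice_normS_le[OF Sig_sym Sig_pd])+
  have B6: "?N w \<le> real n * \<delta> / 6" if "w \<in> B" for w
  proof -
    have "real n * \<delta>' \<le> real n * (\<delta> / 2)" using \<delta>'_le by (intro mult_left_mono) auto
    then show ?thesis using that by (simp add: B_def)
  qed
  \<comment> \<open>A point of \<open>B\<close> has radius at most one sixth of
    \<open>n * \<delta>\<close>, and \<open>radius\<close> allows one twelfth more: together one
    quarter, the radius of \<open>C\<close>. All \<open>y\<close> no longer than a jump are covered,
    since the Taylor bounds evaluate differences of \<open>h\<close> along whole paths.\<close>
  have BC: "w + y \<in> C" if w: "w \<in> B" and J: "J \<in> Js" and y: "norm (rvec y) \<le> norm (rvec J)" for w y J
  proof -
    have "normS Sig (rvec y) \<le> sqrt (rho Sig) * normS Sig (rvec J)"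
      by (rule normS_le_of_norm_le[OF Sig_sym Sig_pd y])
    also have "\<dots> \<le> sqrt (rho Sig) * JSmax Js Sig"
      using lam JSmax_ge[OF Sig_sym Sig_pd Js_fin J] by (intro mult_left_mono) auto
    finally have "normS Sig (rvec y) \<le> real n * \<delta> / 12" using radius by linarith
    moreover have eq: "rvec (w + y) - real n *\<^sub>R c = (rvec w - real n *\<^sub>R c) + rvec y"
      by (simp add: rvec_def vec_eq_iff)
    have "?N (w + y) \<le> ?N w + normS Sig (rvec y)"
      unfolding eq by (rule normS_triangle[OF Sig_sym Sig_pd])
    ultimately show ?thesis using B6[OF w] unfolding C_def mem_Collect_eq by linarith
  qed
  have CB: "X \<in> Btilde Sig n \<delta> c" if "X \<in> C" for X
  proof -
    have "real n * \<delta> / 4 \<le> real n * \<delta>" using \<delta> by simp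
    then show ?thesis using that unfolding C_def Btilde_def mem_Collect_eq by linarith
  qed
  have BinC: "w \<in> C" if "w \<in> B" for w
    using BC[OF that, of _ 0] Js_ne by (auto simp: rvec_def zero_vec_def[symmetric])

  \<comment> \<open>Rescaled displacement: range, moments and tail\<close>
  define \<xi> where "\<xi> w = inverse (real n) *\<^sub>R rvec w - c" for w
  have \<xi>N: "(norm (\<xi> w))\<^sup>2 \<le> ?lm * (?N w)\<^sup>2 / (real n)\<^sup>2" for w
  proof -
    have "\<xi> w = inverse (real n) *\<^sub>R (rvec w - real n *\<^sub>R c)"
      using n by (simp add: \<xi>_def algebra_simps)
    then have "(norm (\<xi> w))\<^sup>2 = (norm (rvec w - real n *\<^sub>R c))\<^sup>2 / (real n)\<^sup>2"
      by (simp add: power_mult_distrib divide_inverse power_inverse mult.commute)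
    then show ?thesis
      using norm_le_normS[OF Sig_sym Sig_pd, of "rvec w - real n *\<^sub>R c"] by (simp add: divide_right_mono)
  qed
  \<comment> \<open>The factor 6 gained from the radius of \<open>B\<close> provides the strict
    inequality that \<open>gradient_Taylor_bound\<close> demands.\<close>
  have \<xi>\<delta>: "norm (\<xi> w) < \<delta>0" if "w \<in> B" for w
  proof -
    have "(?N w)\<^sup>2 \<le> (real n * \<delta> / 6)\<^sup>2"
      using B6[OF that] normS_nonneg[OF Sig_sym Sig_pd] by (intro power_mono) auto
    then have "?lm * (?N w)\<^sup>2 / (real n)\<^sup>2 \<le> ?lm * (real n * \<delta> / 6)\<^sup>2 / (real n)\<^sup>2"
      using lam by (intro divide_right_mono mult_left_mono) auto
    also have "\<dots> = (sqrt ?lm * \<delta> / 6)\<^sup>2"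
      using n lam by (simp add: power_mult_distrib power_divide)
    finally have "(norm (\<xi> w))\<^sup>2 \<le> (sqrt ?lm * \<delta> / 6)\<^sup>2" using \<xi>N[of w] by linarith
    then have "norm (\<xi> w) \<le> sqrt ?lm * \<delta> / 6"
      using lam \<delta> by (intro power2_le_imp_le[of "norm (\<xi> w)"]) auto
    also have "\<dots> \<le> \<delta>0 / 6" using \<delta>_le lam by (simp add: field_simps)
    finally show ?thesis using \<delta>0_pos by linarith
  qed
  have p1: "(\<Sum>w\<in>B. pmf p w) \<le> 1"
    using measure_pmf.prob_le_1[of p B] by (simp add: measure_measure_pmf_finite[OF finB])
  have K0: "0 \<le> ?d * v * real n" using v_pos by simp
  have mom: "(\<Sum>w\<in>B. pmf p w * (?N w)\<^sup>2) \<le> ?d * v * real n"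
    by (rule pmf_sum_le_nn_integral[OF finB _ K0 W_mom]) simp
  define s2 where "s2 = ?lm * ?d * v / real n"
  have s2: "0 < s2" using lam v_pos n by (simp add: s2_def)
  have mom\<xi>: "(\<Sum>w\<in>B. pmf p w * (norm (\<xi> w))\<^sup>2) \<le> s2"
  proof -
    have "(\<Sum>w\<in>B. pmf p w * (norm (\<xi> w))\<^sup>2) \<le> (\<Sum>w\<in>B. pmf p w * (?lm * (?N w)\<^sup>2 / (real n)\<^sup>2))"
      by (intro sum_mono mult_left_mono \<xi>N) simp
    also have "\<dots> = ?lm / (real n)\<^sup>2 * (\<Sum>w\<in>B. pmf p w * (?N w)\<^sup>2)"
      by (simp add: sum_distrib_left algebra_simps)
    also have "\<dots> \<le> ?lm / (real n)\<^sup>2 * (?d * v * real n)"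
      using lam by (intro mult_left_mono mom) auto
    also have "\<dots> = s2" using n by (simp add: s2_def power2_eq_square)
    finally show ?thesis .
  qed
  have mom1: "(\<Sum>w\<in>B. pmf p w * norm (\<xi> w)) \<le> sqrt s2"
  proof (rule weighted_sum_le_sqrt[where p = "pmf p"])
    show "(\<Sum>w\<in>B. pmf p w * (norm (\<xi> w))\<^sup>2) \<le> (sqrt s2)\<^sup>2" using mom\<xi> s2 by simp
  qed (use p1 s2 in auto)
  \<comment> \<open>Markov's inequality at the radius of \<open>B\<close>; the 9 is the square of
    the 3 in that radius.\<close>
  have tail: "measure_pmf.prob p (- B) \<le> 9 * ?d * v / (real n * \<delta>'\<^sup>2)"
  proof -
    have "(real n * \<delta>' / 3)\<^sup>2 * measure_pmf.prob p (- B) \<le> ?d * v * real n"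
    proof (rule pmf_Markov[OF _ _ K0 W_mom])
      fix w assume "w \<in> - B"
      then show "(real n * \<delta>' / 3)\<^sup>2 \<le> (?N w)\<^sup>2"
        using n \<delta>'_pos by (intro power_mono) (auto simp: B_def)
    qed simp
    then show ?thesis using n \<delta>'_pos by (simp add: field_simps power2_eq_square)
  qed

  \<comment> \<open>Local bounds for the differences of h\<close>
  define M1 where "M1 = normD1 Sig n c h (real n * \<delta> / 4)"
  define M2 where "M2 = normD2 Sig n c h (real n * \<delta> / 4)"
  have M1: "\<bar>Delta j h X\<bar> \<le> M1" if "X \<in> C" for j X
    using that Delta_le_normD1[OF Sig_sym Sig_pd] by (simp add: C_def M1_def)
  have M2: "\<bar>Delta2 j k h X\<bar> \<le> M2" if "X \<in> C" for j k X
    using that Delta2_le_normD2[OF Sig_sym Sig_pd] by (simp add: C_def M2_def)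
  have M_nn: "0 \<le> M1" "0 \<le> M2"
    unfolding M1_def M2_def by (rule normD1_nonneg[OF Sig_sym Sig_pd] normD2_nonneg[OF Sig_sym Sig_pd])+

  \<comment> \<open>Jump moments weighted by the rates at c\<close>
  define \<Lambda> where "\<Lambda> = Lambda_bar Js g c"
  have trace: "(\<Sum>J\<in>Js. g J c * (norm (rvec J))\<^sup>2) = ?d * \<Lambda>"
    by (simp add: \<Lambda>_def Lambda_bar_def trace_sigma2)
  have \<Lambda>: "0 < \<Lambda>"
  proof -
    let ?J = "- ee undefined :: int^'d"
    have "rvec ?J $ undefined \<noteq> 0" by (simp add: rvec_def ee_def axis_def)
    then have "rvec ?J \<noteq> 0" by (metis zero_index)
    then have "0 < (\<Sum>J\<in>Js. g J c * (norm (rvec J))\<^sup>2)"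
      using unit[of undefined] g_nonneg by (intro sum_pos2[OF Js_fin, of ?J]) auto
    then show ?thesis unfolding trace by (simp add: zero_less_mult_iff)
  qed
  define S3 where "S3 = (\<Sum>J\<in>Js. g J c * norm (rvec J) ^ 3)"
  have l1_1: "(\<Sum>J\<in>Js. g J c * l1 J) \<le> ?d * \<Lambda>"
    unfolding trace[symmetric] by (intro sum_mono mult_left_mono l1_le_norm_square g_nonneg)
  have l1_2: "(\<Sum>J\<in>Js. g J c * (l1 J)\<^sup>2) \<le> ?d * (?d * \<Lambda>)"
  proof -
    have "(l1 J)\<^sup>2 \<le> ?d * (norm (rvec J))\<^sup>2" for J :: "int^'d"
      using power_mono[OF l1_le_norm l1_nonneg, of J 2] by (simp add: power_mult_distrib)
    then have "(\<Sum>J\<in>Js. g J c * (l1 J)\<^sup>2) \<le> (\<Sum>J\<in>Js. g J c * (?d * (norm (rvec J))\<^sup>2))"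
      by (intro sum_mono mult_left_mono g_nonneg)
    also have "\<dots> = ?d * (?d * \<Lambda>)"
      unfolding trace[symmetric] by (simp add: sum_distrib_left algebra_simps)
    finally show ?thesis .
  qed
  \<comment> \<open>The \<open>coord_sum\<close> correction from the Taylor bounds cancels here: its
    weighted sum adds up the coordinates of the drift at \<open>c\<close>.\<close>
  have l1_3: "(\<Sum>J\<in>Js. g J c * (l1 J ^ 3 - coord_sum J)) \<le> sqrt ?d ^ 3 * S3"
  proof -
    have "(\<Sum>J\<in>Js. g J c * coord_sum J) = (\<Sum>i\<in>UNIV. (Fdrift Js g c) $ i)"
      unfolding coord_sum_def sum_distrib_left Fdrift_def
      by (subst sum.swap) (simp add: rvec_def)
    then have "(\<Sum>J\<in>Js. g J c * (l1 J ^ 3 - coord_sum J)) = (\<Sum>J\<in>Js. g J c * l1 J ^ 3)"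
      by (simp add: G0 right_diff_distrib sum_subtractf)
    also have "\<dots> \<le> (\<Sum>J\<in>Js. g J c * (sqrt ?d * norm (rvec J)) ^ 3)"
      by (intro sum_mono mult_left_mono power_mono l1_le_norm l1_nonneg g_nonneg)
    also have "\<dots> = sqrt ?d ^ 3 * S3"
      by (simp add: S3_def sum_distrib_left power_mult_distrib algebra_simps)
    finally show ?thesis .
  qed

  \<comment> \<open>Splitting of the generator difference\<close>
  have A_eq: "A *v y = (\<Sum>J\<in>Js. (Dg J c \<bullet> y) *\<^sub>R rvec J)" for y
  proof (rule drift_derivative_eq[OF A_def])
    fix J assume "J \<in> Js"
    moreover have "at c within cball c \<delta>0 = at c"
      using \<delta>0_pos by (intro at_within_interior) (simp add: interior_cball)
    ultimately show "(g J has_derivative (\<lambda>y. Dg J c \<bullet> y)) (at c)"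
      using G2_D1[of J c] cb by simp
  qed

  define I1 where "I1 w = real n * (\<Sum>J\<in>Js. (g J (c + \<xi> w) - g J c - Dg J c \<bullet> \<xi> w) * jump_diff h J w)" for w
  define I2 where "I2 w = real n * (\<Sum>J\<in>Js. (g J (c + \<xi> w) - g J c) * Taylor1_rem h J w)" for w
  define I3 where "I3 w = real n * (\<Sum>J\<in>Js. g J c * (Taylor1_rem h J w - quad_part (\<lambda>j k. Delta2 j k h w) J))" for w
  have diff: "gen_A Js g Sig n \<delta> c h w - simp_A (sigma2 Js g c) A n c h w = I1 w + I2 w + I3 w"
    if "w \<in> B" for w
    unfolding I1_def I2_def I3_def
    using BC[OF that] BinC[OF that] CB by (intro generator_difference[OF n G0 A_eq]) (auto simp: \<xi>_def)

  \<comment> \<open>Estimates of the three error terms\<close>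
  have T1: "\<bar>\<Sum>w\<in>B. pmf p w * I1 w\<bar>
      \<le> real n * (L2 Js g D2g c \<delta>0 / 2 * M1 * (?d * \<Lambda>) * s2)"
  proof -
    have "\<bar>I1 w\<bar> \<le> real n * (L2 Js g D2g c \<delta>0 / 2 * M1 * (?d * \<Lambda>)) * (norm (\<xi> w))\<^sup>2" if w: "w \<in> B" for w
    proof -
      have "\<bar>\<Sum>J\<in>Js. (g J (c + \<xi> w) - g J c - Dg J c \<bullet> \<xi> w) * jump_diff h J w\<bar>
        \<le> (\<Sum>J\<in>Js. (L2 Js g D2g c \<delta>0 * g J c / 2 * (norm (\<xi> w))\<^sup>2) * (l1 J * M1))"
      proof (rule order_trans[OF sum_abs sum_mono])
        fix J assume J: "J \<in> Js"
        have "\<bar>g J (c + \<xi> w) - g J c - Dg J c \<bullet> \<xi> w\<bar> \<le> L2 Js g D2g c \<delta>0 * g J c / 2 * (norm (\<xi> w))\<^sup>2"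
          by (rule gradient_Taylor_bound[OF G2_D1[OF J] G2_D2[OF J] L2[OF J] \<xi>\<delta>[OF w]])
        moreover have "\<bar>jump_diff h J w\<bar> \<le> l1 J * M1"
          by (rule jump_diff_bound) (rule M1[OF BinC[OF w]])
        ultimately show "\<bar>(g J (c + \<xi> w) - g J c - Dg J c \<bullet> \<xi> w) * jump_diff h J w\<bar>
            \<le> (L2 Js g D2g c \<delta>0 * g J c / 2 * (norm (\<xi> w))\<^sup>2) * (l1 J * M1)"
          unfolding abs_mult by (intro mult_mono) (auto simp: L2_nn g_nonneg)
      qed
      also have "\<dots> = L2 Js g D2g c \<delta>0 / 2 * M1 * (norm (\<xi> w))\<^sup>2 * (\<Sum>J\<in>Js. g J c * l1 J)"
        by (simp add: sum_distrib_left algebra_simps)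
      also have "\<dots> \<le> L2 Js g D2g c \<delta>0 / 2 * M1 * (norm (\<xi> w))\<^sup>2 * (?d * \<Lambda>)"
        using L2_nn M_nn by (intro mult_left_mono l1_1) auto
      finally have "real n * \<bar>\<Sum>J\<in>Js. (g J (c + \<xi> w) - g J c - Dg J c \<bullet> \<xi> w) * jump_diff h J w\<bar>
          \<le> real n * (L2 Js g D2g c \<delta>0 / 2 * M1 * (norm (\<xi> w))\<^sup>2 * (?d * \<Lambda>))"
        by (rule mult_left_mono) simp
      then show ?thesis by (simp add: I1_def abs_mult mult_ac)
    qed
    then have "\<bar>\<Sum>w\<in>B. pmf p w * I1 w\<bar>
        \<le> real n * (L2 Js g D2g c \<delta>0 / 2 * M1 * (?d * \<Lambda>)) * (\<Sum>w\<in>B. pmf p w * (norm (\<xi> w))\<^sup>2)"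
      by (rule weighted_sum_abs_le) simp_all
    also have "\<dots> \<le> real n * (L2 Js g D2g c \<delta>0 / 2 * M1 * (?d * \<Lambda>)) * s2"
      using L2_nn M_nn \<Lambda> by (intro mult_left_mono mom\<xi>) auto
    finally show ?thesis by (simp add: mult.assoc)
  qed
  have T2: "\<bar>\<Sum>w\<in>B. pmf p w * I2 w\<bar>
      \<le> real n * (L1 Js g Dg c \<delta>0 * M2 * (?d * (?d * \<Lambda>)) * sqrt s2)"
  proof -
    have "\<bar>I2 w\<bar> \<le> real n * (L1 Js g Dg c \<delta>0 * M2 * (?d * (?d * \<Lambda>))) * norm (\<xi> w)" if w: "w \<in> B" for w
    proof -
      have "\<bar>\<Sum>J\<in>Js. (g J (c + \<xi> w) - g J c) * Taylor1_rem h J w\<bar>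
        \<le> (\<Sum>J\<in>Js. (L1 Js g Dg c \<delta>0 * g J c * norm (\<xi> w)) * (M2 * (l1 J)\<^sup>2))"
      proof (rule order_trans[OF sum_abs sum_mono])
        fix J assume J: "J \<in> Js"
        have "c + \<xi> w \<in> cball c \<delta>0" using \<xi>\<delta>[OF w] by (simp add: dist_norm)
        from gradient_increment_bound[OF G2_D1[OF J] L1[OF J] this]
        have "\<bar>g J (c + \<xi> w) - g J c\<bar> \<le> L1 Js g Dg c \<delta>0 * g J c * norm (\<xi> w)" by simp
        moreover have "\<bar>Taylor1_rem h J w\<bar> \<le> M2 * (l1 J)\<^sup>2"
          by (rule Taylor1_rem_bound[OF M2[OF BC[OF w J]] M_nn(2)])
        ultimately show "\<bar>(g J (c + \<xi> w) - g J c) * Taylor1_rem h J w\<bar>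
            \<le> (L1 Js g Dg c \<delta>0 * g J c * norm (\<xi> w)) * (M2 * (l1 J)\<^sup>2)"
          unfolding abs_mult by (intro mult_mono) (auto simp: L1_nn g_nonneg)
      qed
      also have "\<dots> = L1 Js g Dg c \<delta>0 * M2 * norm (\<xi> w) * (\<Sum>J\<in>Js. g J c * (l1 J)\<^sup>2)"
        by (simp add: sum_distrib_left algebra_simps)
      also have "\<dots> \<le> L1 Js g Dg c \<delta>0 * M2 * norm (\<xi> w) * (?d * (?d * \<Lambda>))"
        using L1_nn M_nn by (intro mult_left_mono l1_2) auto
      finally have "real n * \<bar>\<Sum>J\<in>Js. (g J (c + \<xi> w) - g J c) * Taylor1_rem h J w\<bar>
          \<le> real n * (L1 Js g Dg c \<delta>0 * M2 * norm (\<xi> w) * (?d * (?d * \<Lambda>)))"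
        by (rule mult_left_mono) simp
      then show ?thesis by (simp add: I2_def abs_mult mult_ac)
    qed
    then have "\<bar>\<Sum>w\<in>B. pmf p w * I2 w\<bar>
        \<le> real n * (L1 Js g Dg c \<delta>0 * M2 * (?d * (?d * \<Lambda>))) * (\<Sum>w\<in>B. pmf p w * norm (\<xi> w))"
      by (rule weighted_sum_abs_le) simp_all
    also have "\<dots> \<le> real n * (L1 Js g Dg c \<delta>0 * M2 * (?d * (?d * \<Lambda>))) * sqrt s2"
      using L1_nn M_nn \<Lambda> by (intro mult_left_mono mom1) auto
    finally show ?thesis by (simp add: mult.assoc)
  qed
  have T3: "\<bar>\<Sum>w\<in>B. pmf p w * I3 w\<bar>
      \<le> real n * (M2 * \<epsilon> * (sqrt ?d ^ 3 * S3) + 2 * M2 * measure_pmf.prob p (- B) * (?d * (?d * \<Lambda>)))"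
  proof -
    let ?R = "\<lambda>J w. Taylor1_rem h J w - quad_part (\<lambda>j k. Delta2 j k h w) J"
    \<comment> \<open>The sums are exchanged before any absolute value is taken: the smallness of
      this term rests on cancellation in the average over \<open>w\<close>, separately for each
      jump.\<close>
    have "(\<Sum>w\<in>B. pmf p w * I3 w) = (\<Sum>w\<in>B. \<Sum>J\<in>Js. real n * (g J c * (pmf p w * ?R J w)))"
      unfolding I3_def sum_distrib_left by (intro sum.cong refl) (simp add: mult_ac)
    also have "\<dots> = real n * (\<Sum>J\<in>Js. g J c * (\<Sum>w\<in>B. pmf p w * ?R J w))"
      unfolding sum_distrib_left by (rule sum.swap)
    finally have "\<bar>\<Sum>w\<in>B. pmf p w * I3 w\<bar> = real n * \<bar>\<Sum>J\<in>Js. g J c * (\<Sum>w\<in>B. pmf p w * ?R J w)\<bar>"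
      by (simp add: abs_mult)
    also have "\<dots> \<le> real n * (\<Sum>J\<in>Js. g J c * (M2 * \<epsilon> * (l1 J ^ 3 - coord_sum J)
        + 2 * M2 * measure_pmf.prob p (- B) * (l1 J)\<^sup>2))"
    proof (intro mult_left_mono order_trans[OF sum_abs sum_mono])
      fix J assume J: "J \<in> Js"
      have "\<bar>\<Sum>w\<in>B. pmf p w * ?R J w\<bar> \<le> M2 * \<epsilon> * (l1 J ^ 3 - coord_sum J)
          + 2 * M2 * measure_pmf.prob p (- B) * (l1 J)\<^sup>2"
        using BC[OF _ J] M2 M_nn W_tv \<epsilon>_pos by (intro Taylor2_expectation_bound[OF finB finC]) auto
      then show "\<bar>g J c * (\<Sum>w\<in>B. pmf p w * ?R J w)\<bar> \<le> g J c * (M2 * \<epsilon> * (l1 J ^ 3 - coord_sum J)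
          + 2 * M2 * measure_pmf.prob p (- B) * (l1 J)\<^sup>2)"
        by (simp add: abs_mult g_nonneg mult_left_mono)
    qed simp
    also have "\<dots> = real n * (M2 * \<epsilon> * (\<Sum>J\<in>Js. g J c * (l1 J ^ 3 - coord_sum J))
        + 2 * M2 * measure_pmf.prob p (- B) * (\<Sum>J\<in>Js. g J c * (l1 J)\<^sup>2))"
      unfolding sum_distrib_left[of "M2 * \<epsilon>"] sum_distrib_left[of "2 * M2 * measure_pmf.prob p (- B)"]
        sum.distrib[symmetric]
      by (intro arg_cong[where f = "(*) (real n)"] sum.cong refl) (simp only: distrib_left mult_ac)
    also have "\<dots> \<le> real n * (M2 * \<epsilon> * (sqrt ?d ^ 3 * S3) + 2 * M2 * measure_pmf.prob p (- B) * (?d * (?d * \<Lambda>)))"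
      using M_nn \<epsilon>_pos by (intro mult_left_mono add_mono l1_2 l1_3) auto
    finally show ?thesis .
  qed

  \<comment> \<open>Assembly of the final bound\<close>
  have "measure_pmf.expectation p
      (\<lambda>w. (gen_A Js g Sig n \<delta> c h w - simp_A (sigma2 Js g c) A n c h w) * indicator B w)
     = (\<Sum>w\<in>B. (gen_A Js g Sig n \<delta> c h w - simp_A (sigma2 Js g c) A n c h w) * indicator B w * pmf p w)"
    by (rule integral_measure_pmf_real[OF finB]) (auto simp: indicator_def split: if_splits)
  also have "\<dots> = (\<Sum>w\<in>B. pmf p w * I1 w) + (\<Sum>w\<in>B. pmf p w * I2 w) + (\<Sum>w\<in>B. pmf p w * I3 w)"
    unfolding sum.distrib[symmetric] by (intro sum.cong refl) (simp add: diff algebra_simps)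
  finally have "\<bar>measure_pmf.expectation p
      (\<lambda>w. (gen_A Js g Sig n \<delta> c h w - simp_A (sigma2 Js g c) A n c h w) * indicator B w)\<bar>
     \<le> \<bar>\<Sum>w\<in>B. pmf p w * I1 w\<bar> + \<bar>\<Sum>w\<in>B. pmf p w * I2 w\<bar> + \<bar>\<Sum>w\<in>B. pmf p w * I3 w\<bar>"
    by linarith
  \<comment> \<open>\<open>error_terms_combine\<close> with \<open>D = sqrt ?d\<close>; the steps
    after it rewrite natural powers of square roots as the real powers of the claim.\<close>
  also have "\<dots> \<le> sqrt ?d ^ 5 * \<Lambda> * (1/2 * L2 Js g D2g c \<delta>0 * ?lm * v * M1 + real n * M2 *
     (L1 Js g Dg c \<delta>0 * sqrt (v * ?lm) * (1 / sqrt (real n)) + sqrt ?d * (S3 / sqrt ?d ^ 3 / \<Lambda>) * \<epsilon>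
      + 32 * sqrt ?d * v / (real n * \<delta>'\<^sup>2)))"
    using T1 T2 T3 tail d1 n \<Lambda> lam v_pos \<delta>'_pos L2_nn M_nn unfolding s2_def
    by (intro error_terms_combine[where P = "measure_pmf.prob p (- B)"]) auto
  also have "sqrt ?d ^ 5 = ?d powr (5/2)"
    by (simp add: powr_half_sqrt[symmetric] powr_powr flip: powr_realpow)
  also have "S3 / sqrt ?d ^ 3 = gamma_bar Js g c"
  proof -
    have "sqrt ?d ^ 3 = ?d powr (3/2)"
      by (simp add: powr_half_sqrt[symmetric] powr_powr flip: powr_realpow)
    moreover have "?d powr (-3/2) = inverse (?d powr (3/2))"
      using powr_minus[of ?d "3/2"] by simp
    ultimately show ?thesis by (simp only: gamma_bar_def S3_def divide_inverse mult.commute)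
  qed
  also have "1 / sqrt (real n) = real n powr (-1/2)"
    using powr_minus[of "real n" "1/2"] by (simp add: powr_half_sqrt inverse_eq_divide)
  finally show ?thesis unfolding B_def M1_def M2_def \<Lambda>_def .
qed

end
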